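(* Let $R_0:[0,\infty)\to\mathrm{SO}(3)$, $\Omega_0:[0,\infty)\to\mathbb R^3$ and $u_0:[0,\infty)\to\mathbb R^3$ be smooth and bounded with $$\dot R_0(t)=R_0(t)\hat\Omega_0(t),\qquad\dot\Omega_0(t)=u_0(t)\qquad\text{for all }t\ge0.$$ For $(R,\Omega)\in\mathrm{SO}(3)\times\mathbb R^3$ put $$\Delta\Omega=\Omega-\Omega_0(t),\qquad Z_k=\mathrm{Skew}(R_0(t)^T(R-R_0(t)))=\mathrm{Skew}(R_0(t)^TR).$$ Consider the controller $u=u_0+\Delta u$, where $\Delta u$ is any one of the following four: (i) $\Delta u=-K_PZ_k^\vee-K_D(Z_k^\vee\times\Omega_0+\Delta\Omega)-(Z_k^\vee\times\Omega_0+\Delta\Omega)\times\Omega_0-Z_k^\vee\times u_0$, where $K_P,K_D\in\mathbb R^{3\times3}$ are such that $\begin{bmatrix}0&I\\-K_P&-K_D\end{bmatrix}$ is Hurwitz; (ii) $\Delta u=-K_PZ_k^\vee-K_D(Z_k^\vee\times\Omega_0+\Delta\Omega)-K_I\int_0^tZ_k^\vee(\tau)\,d\tau-(Z_k^\vee\times\Omega_0+\Delta\Omega)\times\Omega_0-Z_k^\vee\times u_0$, where $K_P,K_D,K_I\in\mathbb R^{3\times3}$ are such that the polynomial $\det(\lambda^3I+\lambda^2K_D+\lambda K_P+K_I)$ in $\lambda$ is Hurwitz; (iii) $\Delta u=-k_PZ_k^\vee-K_D\Delta\Omega$, where $k_P>0$ and $K_D\in\mathbb R^{3\times3}$ is symmetric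 positive definite; (iv) $\Delta u=-k_PZ_k^\vee-K_D\Delta\Omega-\epsilon(Z_k^\vee\times\Omega_0)$, where $k_P>0$, $K_D\in\mathbb R^{3\times3}$ is symmetric positive definite and $$0<\epsilon<\min\left\{\sqrt{k_P},\ \frac{4k_P\lambda_{\min}(K_D)}{4k_P+(\lambda_{\max}(K_D))^2}\right\}.$$ Then the controller enables the free rigid body system $$\dot R=R\hat\Omega,\qquad\dot\Omega=u,\qquad(R,\Omega)\in\mathrm{SO}(3)\times\mathbb R^3,$$ to track the reference trajectory $(R_0(t),\Omega_0(t))$ exponentially.
   Context: $\mathrm{Skew}(A)=\frac12(A-A^T)$ for a square matrix $A$. The hat map $\wedge:\mathbb R^3\to\mathfrak{so}(3)$ sends $\Omega=(\Omega_1,\Omega_2,\Omega_3)$ to $\hat\Omega=\begin{bmatrix}0&-\Omega_3&\Omega_2\\ \Omega_3&0&-\Omega_1\\ -\Omega_2&\Omega_1&0\end{bmatrix}$, and $\vee:\mathfrak{so}(3)\to\mathbb R^3$ is its inverse. A matrix (polynomial) is Hurwitz if all its eigenvalues (roots) have negative real part. $\lambda_{\min},\lambda_{\max}$ denote the smallest and largest eigenvalue. Exponential tracking (understood locally): with $e(t)=\|R(t)-R_0(t)\|+\|\Omega(t)-\Omega_0(t)\|$ (Frobenius and Euclidean norms), there are $C,c,\delta>0$ such that every closed-loop solution in $\mathrm{SO}(3)\times\mathbb R^3$ starting at time $t_0$ with $e(t_0)<\delta$ satisfies $e(t)\le Ce^{-c(t-t_0)}e(t_0)$ for all $t\ge t_0$;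 here $t_0\ge0$ is arbitrary (constants independent of $t_0$), except in case (ii), where the integral term is a dynamic feedback state that is zero at the initial time $t_0=0$. *)

theory Defs
  imports "HOL-Analysis.Analysis" "HOL-Computational_Algebra.Polynomial"
begin

unbundle cross3_syntax

definition skew_part :: "real^'n^'n \<Rightarrow> real^'n^'n" where
  "skew_part A = (1/2) *\<^sub>R (A - transpose A)"

definition SO3 :: "(real^3^3) set" where
  "SO3 = {R. rotation_matrix R}"

definition hat :: "real^3 \<Rightarrow> real^3^3" where
  "hat w = vector [vector [0, - w$3, w$2],
                   vector [w$3, 0, - w$1],
                   vector [- w$2, w$1, 0]]"

text \<open>The inverse is meaningful only on the range of \<open>hat\<close>, the skew-symmetric matrices.\<close>

definition vee :: "real^3^3 \<Rightarrow> real^3" where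
  "vee = inv hat"

lemma vee_hat [simp]: "vee (hat w) = w"
proof -
  have "inj hat"
    by (rule injI) (simp add: hat_def vec_eq_iff forall_3 vector_3)
  then show ?thesis by (simp add: vee_def)
qed

lemma hat_vee:
  assumes "transpose A = - A"
  shows "hat (vee A) = A"
proof -
  have *: "A $ i $ j = - (A $ j $ i)" for i j
  proof -
    have "transpose A $ j $ i = (- A) $ j $ i" by (simp only: assms)
    then show ?thesis by (simp add: transpose_def)
  qed
  have "A $ 1 $ 1 = 0" "A $ 2 $ 2 = 0" "A $ 3 $ 3 = 0"
    using *[of 1 1] *[of 2 2] *[of 3 3] by linarith+
  moreover have "A $ 2 $ 3 = - (A $ 3 $ 2)" "A $ 3 $ 1 = - (A $ 1 $ 3)" "A $ 1 $ 2 = - (A $ 2 $ 1)"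
    by (rule *)+
  ultimately have "A = hat (vector [A$3$2, A$1$3, A$2$1])"
    by (simp add: hat_def vec_eq_iff forall_3 vector_3)
  then show ?thesis by (metis vee_hat)
qed

definition eigenvalues :: "'a::field^'n^'n \<Rightarrow> 'a set" where
  "eigenvalues A = {l. \<exists>v. v \<noteq> 0 \<and> A *v v = l *s v}"

definition complex_matrix :: "real^'n^'m \<Rightarrow> complex^'n^'m" where
  "complex_matrix A = (\<chi> i j. complex_of_real (A $ i $ j))"

definition hurwitz_matrix :: "real^'n^'n \<Rightarrow> bool" where
  "hurwitz_matrix A \<longleftrightarrow> (\<forall>l \<in> eigenvalues (complex_matrix A). Re l < 0)"

definition hurwitz_poly :: "real poly \<Rightarrow> bool" where
  "hurwitz_poly p \<longleftrightarrow> (\<forall>z. poly (map_poly complex_of_real p) z = 0 \<longrightarrow> Re z < 0)"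

definition block_matrix ::
  "'a^'n^'m \<Rightarrow> 'a^'k^'m \<Rightarrow> 'a^'n^'l \<Rightarrow> 'a^'k^'l \<Rightarrow> 'a^('n + 'k)^('m + 'l)" where
  "block_matrix A B C D = (\<chi> i j.
     case i of
       Inl i' \<Rightarrow> (case j of Inl j' \<Rightarrow> A $ i' $ j' | Inr j' \<Rightarrow> B $ i' $ j')
     | Inr i' \<Rightarrow> (case j of Inl j' \<Rightarrow> C $ i' $ j' | Inr j' \<Rightarrow> D $ i' $ j'))"

text \<open>The polynomial \<open>det (\<lambda>\<^sup>3 I + \<lambda>\<^sup>2 K\<^sub>D + \<lambda> K\<^sub>P + K\<^sub>I)\<close>, as the determinant of a matrix
  with polynomial entries.\<close>

definition pid_poly :: "real^'n^'n \<Rightarrow> real^'n^'n \<Rightarrow> real^'n^'n \<Rightarrow> real poly" where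
  "pid_poly KP KD KI = det (\<chi> i j.
     monom ((mat 1 :: real^'n^'n) $ i $ j) 3 + monom (KD $ i $ j) 2
     + monom (KP $ i $ j) 1 + monom (KI $ i $ j) 0)"

definition sym_pos_def :: "real^'n^'n \<Rightarrow> bool" where
  "sym_pos_def A \<longleftrightarrow> transpose A = A \<and> (\<forall>v. v \<noteq> 0 \<longrightarrow> 0 < v \<bullet> (A *v v))"

text \<open>Used for symmetric matrices only, whose eigenvalues are all real.\<close>

definition lambda_min :: "real^'n^'n \<Rightarrow> real" where
  "lambda_min A = Min (eigenvalues A)"

definition lambda_max :: "real^'n^'n \<Rightarrow> real" where
  "lambda_max A = Max (eigenvalues A)"

text \<open>Smoothness on \<open>[0,\<infinity>)\<close>: \<open>D n\<close> is the \<open>n\<close>-th derivative, one-sided at \<open>0\<close>.\<close>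

definition smooth_on_half_line :: "(real \<Rightarrow> 'a::real_normed_vector) \<Rightarrow> bool" where
  "smooth_on_half_line f \<longleftrightarrow>
     (\<exists>D :: nat \<Rightarrow> real \<Rightarrow> 'a.
        (\<forall>t\<ge>0. D 0 t = f t) \<and>
        (\<forall>n. \<forall>t\<ge>0. (D n has_vector_derivative D (Suc n) t) (at t within {0..})))"

definition Zk :: "real^3^3 \<Rightarrow> real^3^3 \<Rightarrow> real^3^3" where
  "Zk R0 R = skew_part (transpose R0 ** (R - R0))"

lemma Zk_eq:
  assumes "R0 \<in> SO3"
  shows "Zk R0 R = skew_part (transpose R0 ** R)"
proof -
  have "transpose R0 ** (R - R0) = transpose R0 ** R - transpose R0 ** R0"
    by (simp add: matrix_matrix_mult_def right_diff_distrib sum_subtractf vec_eq_iff)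
  also have "transpose R0 ** R0 = mat 1"
    using assms by (simp add: SO3_def rotation_matrix_def orthogonal_matrix_def)
  finally have "transpose R0 ** (R - R0) = transpose R0 ** R - mat 1" .
  then show ?thesis
    by (simp add: Zk_def skew_part_def transpose_def vec_eq_iff mat_def)
qed

text \<open>A control law is a map \<open>u\<close> such that \<open>u R \<Omega> t\<close> is the input at time \<open>t\<close> along the trajectory
  \<open>(R, \<Omega>)\<close>; depending on the whole trajectory allows for integral action.
  The reference \<open>(R0, W0, u0)\<close> comes first in the laws below.\<close>

type_synonym control_law = "(real \<Rightarrow> real^3^3) \<Rightarrow> (real \<Rightarrow> real^3) \<Rightarrow> real \<Rightarrow> real^3"

definition control_PD :: "real^3^3 \<Rightarrow> real^3^3 \<Rightarrow>
    (real \<Rightarrow> real^3^3) \<Rightarrow> (real \<Rightarrow> real^3) \<Rightarrow> (real \<Rightarrow> real^3) \<Rightarrow> control_law" where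
  "control_PD KP KD R0 W0 u0 R W t =
     (let z = vee (Zk (R0 t) (R t)); dW = W t - W0 t in
      u0 t + (- (KP *v z) - KD *v ((z \<times> W0 t) + dW)
              - (((z \<times> W0 t) + dW) \<times> W0 t) - (z \<times> u0 t)))"

definition control_PID :: "real^3^3 \<Rightarrow> real^3^3 \<Rightarrow> real^3^3 \<Rightarrow>
    (real \<Rightarrow> real^3^3) \<Rightarrow> (real \<Rightarrow> real^3) \<Rightarrow> (real \<Rightarrow> real^3) \<Rightarrow> control_law" where
  "control_PID KP KD KI R0 W0 u0 R W t =
     (let z = vee (Zk (R0 t) (R t)); dW = W t - W0 t in
      u0 t + (- (KP *v z) - KD *v ((z \<times> W0 t) + dW)
              - KI *v integral {0..t} (\<lambda>s. vee (Zk (R0 s) (R s)))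
              - (((z \<times> W0 t) + dW) \<times> W0 t) - (z \<times> u0 t)))"

definition control_simple :: "real \<Rightarrow> real^3^3 \<Rightarrow>
    (real \<Rightarrow> real^3^3) \<Rightarrow> (real \<Rightarrow> real^3) \<Rightarrow> (real \<Rightarrow> real^3) \<Rightarrow> control_law" where
  "control_simple kP KD R0 W0 u0 R W t =
     (let z = vee (Zk (R0 t) (R t)); dW = W t - W0 t in
      u0 t + (- (kP *\<^sub>R z) - KD *v dW))"

definition control_eps :: "real \<Rightarrow> real^3^3 \<Rightarrow> real \<Rightarrow>
    (real \<Rightarrow> real^3^3) \<Rightarrow> (real \<Rightarrow> real^3) \<Rightarrow> (real \<Rightarrow> real^3) \<Rightarrow> control_law" where
  "control_eps kP KD \<epsilon> R0 W0 u0 R W t =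
     (let z = vee (Zk (R0 t) (R t)); dW = W t - W0 t in
      u0 t + (- (kP *\<^sub>R z) - KD *v dW - \<epsilon> *\<^sub>R (z \<times> W0 t)))"

definition closed_loop_solution ::
  "control_law \<Rightarrow> real \<Rightarrow> (real \<Rightarrow> real^3^3) \<Rightarrow> (real \<Rightarrow> real^3) \<Rightarrow> bool" where
  "closed_loop_solution u t0 R W \<longleftrightarrow>
     (\<forall>t\<ge>t0. R t \<in> SO3 \<and>
        (R has_vector_derivative R t ** hat (W t)) (at t within {t0..}) \<and>
        (W has_vector_derivative u R W t) (at t within {t0..}))"

text \<open>The norm on matrices is the Frobenius norm.\<close>

definition tracking_error ::
  "(real \<Rightarrow> real^3^3) \<Rightarrow> (real \<Rightarrow> real^3) \<Rightarrow> (real \<Rightarrow> real^3^3) \<Rightarrow> (real \<Rightarrow> real^3) \<Rightarrow> real \<Rightarrow> real" where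
  "tracking_error R0 W0 R W t = norm (R t - R0 t) + norm (W t - W0 t)"

text \<open>\<open>T\<close> is the set of admissible initial times; the constants are uniform over it.\<close>

definition tracks_exponentially ::
  "real set \<Rightarrow> control_law \<Rightarrow> (real \<Rightarrow> real^3^3) \<Rightarrow> (real \<Rightarrow> real^3) \<Rightarrow> bool" where
  "tracks_exponentially T u R0 W0 \<longleftrightarrow>
     (\<exists>C>0. \<exists>c>0. \<exists>\<delta>>0. \<forall>t0\<in>T. \<forall>R W.
        closed_loop_solution u t0 R W \<and> tracking_error R0 W0 R W t0 < \<delta> \<longrightarrow>
        (\<forall>t\<ge>t0. tracking_error R0 W0 R W t
                  \<le> C * exp (- c * (t - t0)) * tracking_error R0 W0 R W t0))"

end

theory Submission
  imports Defs "HOL-Computational_Algebra.Fundamental_Theorem_Algebra"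
begin

text \<open>Let \<open>z = vee (Zk R0 R)\<close> and \<open>h = W - W0\<close>. Writing the relative attitude as \<open>R0\<^sup>T R = I + F\<close>, the attitude
error satisfies \<open>z' = z \<times> W0 + h + d\<close> with a defect \<open>d\<close> that is bilinear in \<open>F\<close> and \<open>h\<close>
(\<open>attitude_error_derivative\<close>), and orthogonality of \<open>I + F\<close> makes \<open>F\<close> and \<open>z\<close> comparable near the reference
(\<open>attitude_error_estimates\<close>). In each of the four cases it therefore suffices to find a definite quadratic form
that decreases along the linearised error dynamics; the second order defect and the restriction to small
errors are dealt with once, in \<open>quadratic_lyapunov_tracking\<close>, by a first-exit argument.

For the PD and PID laws the variable \<open>y = z \<times> W0 + h\<close> turns the error dynamics into a linear system with
constant coefficients, whose eigenvalues are the roots of the determinant of a quadratic or cubic matrix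
pencil. A Hurwitz linear map has a quadratic Lyapunov function (\<open>hurwitz_lyapunov\<close>): complex functionals are
estimated one root at a time along a polynomial that annihilates them, which replaces both the matrix
exponential and a triangular form.

For the other two laws the linearisation keeps the coefficient \<open>W0(t)\<close>, and the energy
\<open>(kP \<bar>z\<bar>\<^sup>2 + \<bar>h\<bar>\<^sup>2) / 2 + \<epsilon> z \<bullet> h\<close> decreases (\<open>energy_tracking\<close>). Both are instances of one law with feedback
\<open>- \<sigma> (z \<times> W0)\<close>: without this term \<open>\<epsilon>\<close> has to be small compared with the bound on \<open>W0\<close>, and with \<open>\<sigma> = \<epsilon>\<close>
all terms containing \<open>W0\<close> cancel, which leaves precisely the condition on \<open>\<epsilon>\<close> in terms of the eigenvalues of
the damping matrix.\<close>

section \<open>Quadratic Lyapunov functions of Hurwitz linear maps\<close>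

text \<open>The form \<open>\<beta>\<close> is a quadratic Lyapunov function for \<open>x' = A x\<close>: along solutions the derivative of
\<open>\<beta> x x\<close> is \<open>2 \<beta> x (A x)\<close>. It is only required to be semidefinite, so that functions \<open>q\<close> controlling
some coordinates of the state can be treated one at a time and added up.\<close>

definition dominated :: "('a::euclidean_space \<Rightarrow> 'a) \<Rightarrow> ('a \<Rightarrow> real) \<Rightarrow> bool" where
  "dominated A q \<longleftrightarrow> (\<exists>\<beta> c. bilinear \<beta> \<and> (\<forall>x y. \<beta> x y = \<beta> y x) \<and> (\<forall>x. 0 \<le> \<beta> x x) \<and>
     (\<forall>x. q x \<le> \<beta> x x) \<and> 0 < c \<and> (\<forall>x. \<beta> x (A x) \<le> - c * \<beta> x x))"

lemma dominated_zero: "dominated A (\<lambda>x. 0)"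
  unfolding dominated_def
  by (intro exI[of _ "\<lambda>x y. 0"] exI[of _ "1::real"]) (auto simp: bilinear_def linear_iff)

lemma dominated_add:
  assumes "dominated A p" "dominated A q"
  shows "dominated A (\<lambda>x. p x + q x)"
proof -
  obtain \<beta> c where \<beta>: "bilinear \<beta>" "\<And>x y. \<beta> x y = \<beta> y x" "\<And>x. 0 \<le> \<beta> x x"
      "\<And>x. p x \<le> \<beta> x x" "0 < c" "\<And>x. \<beta> x (A x) \<le> - c * \<beta> x x"
    using assms(1) unfolding dominated_def by blast
  obtain \<gamma> d where \<gamma>: "bilinear \<gamma>" "\<And>x y. \<gamma> x y = \<gamma> y x" "\<And>x. 0 \<le> \<gamma> x x"
      "\<And>x. q x \<le> \<gamma> x x" "0 < d" "\<And>x. \<gamma> x (A x) \<le> - d * \<gamma> x x"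
    using assms(2) unfolding dominated_def by blast
  let ?\<delta> = "\<lambda>x y. \<beta> x y + \<gamma> x y"
  have "bilinear ?\<delta>"
    using \<beta>(1) \<gamma>(1) unfolding bilinear_def by (auto intro: linear_compose_add)
  moreover have "?\<delta> x (A x) \<le> - min c d * ?\<delta> x x" for x
  proof -
    have "min c d * \<beta> x x \<le> c * \<beta> x x" "min c d * \<gamma> x x \<le> d * \<gamma> x x"
      using \<beta>(3) \<gamma>(3) by (auto intro: mult_right_mono)
    then show ?thesis using \<beta>(6)[of x] \<gamma>(6)[of x] by (simp add: algebra_simps)
  qed
  ultimately show ?thesis
    unfolding dominated_def using \<beta> \<gamma>
    by (intro exI[of _ ?\<delta>] exI[of _ "min c d"]) (auto intro: add_mono simp: algebra_simps)
qed

text \<open>Variation of constants in Lyapunov form: along solutions \<open>l\<close> obeys a stable scalar equation driven by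
\<open>g\<close>. By Young's inequality the forcing costs at most a multiple of \<open>\<bar>g\<bar>\<^sup>2\<close>, which a large multiple \<open>K\<close> of
the form dominating \<open>\<bar>g\<bar>\<^sup>2\<close> absorbs.\<close>

lemma dominated_peel:
  fixes A :: "'a::euclidean_space \<Rightarrow> 'a" and l g :: "'a \<Rightarrow> complex"
  assumes l: "linear l" and lA: "\<And>x. l (A x) = lam * l x + g x" and lam: "Re lam < 0"
    and g: "dominated A (\<lambda>x. (cmod (g x))\<^sup>2)"
  shows "dominated A (\<lambda>x. (cmod (l x))\<^sup>2)"
proof -
  obtain \<beta> c where \<beta>: "bilinear \<beta>" "\<And>x y. \<beta> x y = \<beta> y x" "\<And>x. 0 \<le> \<beta> x x"
      "\<And>x. (cmod (g x))\<^sup>2 \<le> \<beta> x x" "0 < c" "\<And>x. \<beta> x (A x) \<le> - c * \<beta> x x"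
    using g unfolding dominated_def by blast
  define a where "a = - Re lam"
  have a: "0 < a" using lam by (simp add: a_def)
  define K where "K = 1 / (a * c)"
  have K: "0 < K" using a \<beta>(5) by (simp add: K_def)
  let ?\<delta> = "\<lambda>x y. l x \<bullet> l y + K * \<beta> x y"
  have "bilinear ?\<delta>"
    using \<beta>(1) l unfolding bilinear_def linear_iff
    by (simp add: inner_add_left inner_add_right algebra_simps)
  moreover have "?\<delta> x (A x) \<le> - min (a/2) (c/2) * ?\<delta> x x" for x
  proof -
    let ?s = "cmod (l x)" and ?h = "cmod (g x)"
    have "l x \<bullet> (lam * l x) = - a * ?s\<^sup>2"
      by (simp add: inner_complex_def a_def cmod_power2) (simp add: power2_eq_square algebra_simps)
    moreover have "l x \<bullet> g x \<le> ?s * ?h" by (rule norm_cauchy_schwarz)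
    ultimately have 1: "l x \<bullet> l (A x) \<le> - a * ?s\<^sup>2 + ?s * ?h"
      by (simp add: lA inner_add_right)
    have "0 \<le> (a * ?s - ?h)\<^sup>2 / (2 * a)" using a by simp
    also have "\<dots> = a / 2 * ?s\<^sup>2 - ?s * ?h + ?h\<^sup>2 / (2 * a)"
      using a by (simp add: power2_eq_square field_simps)
    also have "\<dots> \<le> a / 2 * ?s\<^sup>2 - ?s * ?h + \<beta> x x / (2 * a)"
      using \<beta>(4)[of x] a by (simp add: divide_right_mono)
    finally have 2: "?s * ?h \<le> a / 2 * ?s\<^sup>2 + \<beta> x x / (2 * a)" by simp
    have "K * \<beta> x (A x) \<le> K * (- c * \<beta> x x)"
      by (intro mult_left_mono \<beta>(6)) (use K in simp)
    also have "\<dots> = - (\<beta> x x / a)" using a \<beta>(5) by (simp add: K_def)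
    finally have 3: "K * \<beta> x (A x) \<le> - (\<beta> x x / a)" .
    have 4: "\<beta> x x / (2 * a) = c / 2 * (K * \<beta> x x)" "\<beta> x x / a = c * (K * \<beta> x x)"
      using a \<beta>(5) by (simp_all add: K_def)
    have "min (a/2) (c/2) * ?s\<^sup>2 \<le> a / 2 * ?s\<^sup>2" by (intro mult_right_mono) auto
    moreover have "min (a/2) (c/2) * (K * \<beta> x x) \<le> c / 2 * (K * \<beta> x x)"
      by (intro mult_right_mono) (use K \<beta>(3) in auto)
    moreover have "?\<delta> x x = ?s\<^sup>2 + K * \<beta> x x" by (simp add: power2_norm_eq_inner)
    ultimately show ?thesis using 1 2 3 unfolding 4 by (simp add: algebra_simps)
  qed
  ultimately show ?thesis
    unfolding dominated_def using \<beta> a K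
    by (intro exI[of _ ?\<delta>] exI[of _ "min (a/2) (c/2)"])
       (auto simp: inner_commute power2_norm_eq_inner)
qed

text \<open>Applying \<open>(X - a) r\<close> to the shift operator on sequences is applying \<open>r\<close> after \<open>s \<mapsto> (\<lambda>i. s (Suc i) - a s i)\<close>;
with \<open>s i = l (A\<^sup>i x)\<close> this factors a polynomial in \<open>A\<close>.\<close>

lemma sum_coeff_linear_factor:
  fixes r :: "'a::field poly" and s :: "nat \<Rightarrow> 'a"
  assumes "r \<noteq> 0"
  shows "(\<Sum>i\<le>degree ([:- a, 1:] * r). coeff ([:- a, 1:] * r) i * s i)
       = (\<Sum>i\<le>degree r. coeff r i * (s (Suc i) - a * s i))"
proof -
  have "degree ([:- a, 1:] * r) = Suc (degree r)"
    using assms by (subst degree_mult_eq) auto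
  moreover have "coeff ([:- a, 1:] * r) i = coeff (pCons 0 r) i - a * coeff r i" for i
    by (simp add: mult_pCons_left)
  ultimately have "(\<Sum>i\<le>degree ([:- a, 1:] * r). coeff ([:- a, 1:] * r) i * s i)
      = (\<Sum>i\<le>Suc (degree r). coeff (pCons 0 r) i * s i)
        - (\<Sum>i\<le>Suc (degree r). a * coeff r i * s i)"
    by (simp only: left_diff_distrib sum_subtractf)
  also have "(\<Sum>i\<le>Suc (degree r). coeff (pCons 0 r) i * s i) = (\<Sum>i\<le>degree r. coeff r i * s (Suc i))"
    by (subst sum.atMost_Suc_shift) simp
  also have "(\<Sum>i\<le>Suc (degree r). a * coeff r i * s i) = (\<Sum>i\<le>degree r. a * coeff r i * s i)"
    by (simp add: coeff_eq_0)
  finally show ?thesis by (simp add: sum_subtractf algebra_simps)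
qed

text \<open>The spectral condition is put on left eigenvectors, that is on complex-valued functionals, because these are
the coordinates from which the Lyapunov function is assembled. For second and third order systems they are
also read off directly from the last block of the functional.\<close>

definition left_hurwitz :: "('a::euclidean_space \<Rightarrow> 'a) \<Rightarrow> bool" where
  "left_hurwitz A \<longleftrightarrow> (\<forall>(m :: 'a \<Rightarrow> complex) lam. linear m \<longrightarrow> (\<forall>x. m (A x) = lam * m x) \<longrightarrow>
     (\<exists>x. m x \<noteq> 0) \<longrightarrow> Re lam < 0)"

lemma linear_funpow: "linear A \<Longrightarrow> linear (A ^^ n)" for A :: "'a::real_vector \<Rightarrow> 'a"
  by (induction n) (auto simp: linear_iff)

text \<open>Triangularisation without choosing a basis. If \<open>l \<circ> p(A) = 0\<close> and \<open>p = (X - lam) r\<close>,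
then \<open>g = l \<circ> A - lam l\<close> satisfies \<open>g \<circ> r(A) = 0\<close>, so it is dominated by induction.
When \<open>lam\<close> is an eigenvalue its real part is negative and \<open>l\<close> can be recovered from \<open>g\<close>; otherwise the
functional \<open>l \<circ> r(A)\<close>, which satisfies the eigenvalue equation for \<open>lam\<close>, must vanish, and \<open>r\<close> can
replace \<open>p\<close>.\<close>

lemma dominated_annihilated:
  fixes A :: "'a::euclidean_space \<Rightarrow> 'a" and l :: "'a \<Rightarrow> complex"
  assumes A: "linear A"
    and hurwitz: "left_hurwitz A"
    and "linear l" "p \<noteq> 0" "\<And>x. (\<Sum>i\<le>degree p. coeff p i * l ((A ^^ i) x)) = 0"
  shows "dominated A (\<lambda>x. (cmod (l x))\<^sup>2)"
  using assms(3-)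
proof (induction "degree p" arbitrary: p l rule: less_induct)
  case (less p)
  show ?case
  proof (cases "degree p = 0")
    case True
    then obtain a where "p = [:a:]" by (metis degree_eq_zeroE)
    then have "l x = 0" for x using less.prems(2) less.prems(3)[of x] by simp
    then show ?thesis by (simp add: dominated_zero)
  next
    case False
    then obtain lam where "poly p lam = 0"
      using fundamental_theorem_of_algebra[of p] by (auto simp: constant_degree)
    then obtain r where p: "p = [:- lam, 1:] * r" using poly_eq_0_iff_dvd by (metis dvdE)
    have r: "r \<noteq> 0" using less.prems(2) p by auto
    then have deg: "degree r < degree p" unfolding p by (subst degree_mult_eq) auto
    have lin: "linear (\<lambda>x. l ((A ^^ i) x))" for i
      using linear_compose[OF linear_funpow[OF A] less.prems(1)] by (simp add: o_def)
    define g where "g x = l (A x) - lam * l x" for x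
    have g: "linear g"
      using lin[of 1] less.prems(1) unfolding g_def linear_iff
      by (simp add: algebra_simps scaleR_conv_of_real)
    have zero: "(\<Sum>i\<le>degree r. coeff r i * (l ((A ^^ Suc i) x) - lam * l ((A ^^ i) x))) = 0" for x
      using less.prems(3)[of x] unfolding p by (subst (asm) sum_coeff_linear_factor[OF r])
    have "(\<Sum>i\<le>degree r. coeff r i * g ((A ^^ i) x)) = 0" for x
      using zero[of x] by (simp add: g_def)
    then have dom_g: "dominated A (\<lambda>x. (cmod (g x))\<^sup>2)"
      using less.hyps[OF deg g r] by blast
    define m where "m x = (\<Sum>i\<le>degree r. coeff r i * l ((A ^^ i) x))" for x
    have m: "linear m"
    proof -
      have "linear (\<lambda>x. coeff r i * l ((A ^^ i) x))" for i
        using lin[of i] unfolding linear_iff by (simp add: algebra_simps scaleR_conv_of_real)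
      then show ?thesis unfolding m_def by (intro linear_compose_sum) auto
    qed
    have mA: "m (A x) = lam * m x" for x
      using zero[of x]
      by (simp add: m_def funpow_swap1 sum_subtractf sum_distrib_left algebra_simps)
    show ?thesis
    proof (cases "\<exists>x0. m x0 \<noteq> 0")
      case True
      then have "Re lam < 0" using hurwitz m mA unfolding left_hurwitz_def by blast
      then show ?thesis
        by (intro dominated_peel[OF less.prems(1) _ _ dom_g, of lam]) (auto simp: g_def)
    next
      case False
      then show ?thesis using less.hyps[OF deg less.prems(1) r] by (auto simp: m_def)
    qed
  qed
qed

lemma powers_dependent:
  fixes B :: "'a::euclidean_space \<Rightarrow> 'a"
  obtains c :: "nat \<Rightarrow> real" and N
  where "\<exists>i\<le>N. c i \<noteq> 0" "(\<Sum>i\<le>N. c i *\<^sub>R (B ^^ i) u) = 0"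
proof (cases "inj_on (\<lambda>i. (B ^^ i) u) {..DIM('a)}")
  case True
  let ?S = "(\<lambda>i. (B ^^ i) u) ` {..DIM('a)}"
  have "card ?S = Suc (DIM('a))" using True by (simp add: card_image)
  then have "dependent ?S" by (intro dependent_biggerset) auto
  then obtain f where f: "\<exists>v\<in>?S. f v \<noteq> 0" "(\<Sum>v\<in>?S. f v *\<^sub>R v) = 0"
    using dependent_finite[of ?S] by auto
  then show ?thesis
    using that[of "DIM('a)" "\<lambda>i. f ((B ^^ i) u)"] True by (auto simp: sum.reindex)
next
  case False
  then obtain i j where ij: "i \<le> DIM('a)" "j \<le> DIM('a)" "i \<noteq> j" "(B ^^ i) u = (B ^^ j) u"
    by (auto simp: inj_on_def)
  let ?c = "\<lambda>k. if k = i then 1 else if k = j then - 1 else 0 :: real"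
  have "(\<Sum>k\<le>DIM('a). ?c k *\<^sub>R (B ^^ k) u)
      = (\<Sum>k\<le>DIM('a). (if k = i then (B ^^ i) u else 0) - (if k = j then (B ^^ j) u else 0))"
    using ij by (intro sum.cong) auto
  also have "\<dots> = 0" using ij by (simp add: sum_subtractf)
  finally show ?thesis using that[of "DIM('a)" ?c] ij by (metis one_neq_zero)
qed

text \<open>The iterates of \<open>u\<close> under the adjoint of \<open>A\<close> are linearly dependent; a dependency is a polynomial \<open>p\<close> with
\<open>p(A)\<close> annihilating the functional \<open>x \<mapsto> u \<bullet> x\<close>.\<close>

lemma dominated_inner:
  fixes A :: "'a::euclidean_space \<Rightarrow> 'a" and u :: 'a
  assumes A: "linear A"
    and hurwitz: "left_hurwitz A"
  shows "dominated A (\<lambda>x. (u \<bullet> x)\<^sup>2)"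
proof -
  obtain c N where c: "\<exists>i\<le>N. c i \<noteq> 0" "(\<Sum>i\<le>N. c i *\<^sub>R (adjoint A ^^ i) u) = 0"
    using powers_dependent[where B = "adjoint A" and u = u] by blast
  have adj: "u \<bullet> (A ^^ i) x = (adjoint A ^^ i) u \<bullet> x" for i x
  proof (induction i arbitrary: x)
    case (Suc i)
    have "u \<bullet> (A ^^ Suc i) x = u \<bullet> (A ^^ i) (A x)" by (simp add: funpow_swap1)
    also have "\<dots> = (adjoint A ^^ i) u \<bullet> A x" by (rule Suc.IH)
    also have "\<dots> = adjoint A ((adjoint A ^^ i) u) \<bullet> x"
      using adjoint_works[OF A, of x "(adjoint A ^^ i) u"] by (simp add: inner_commute)
    finally show ?case by simp
  qed simp
  have rel: "(\<Sum>i\<le>N. c i * (u \<bullet> (A ^^ i) x)) = 0" for x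
    using arg_cong[OF c(2), of "\<lambda>v. v \<bullet> x"] by (simp add: inner_sum_left adj)
  define p where "p = (\<Sum>i\<le>N. monom (complex_of_real (c i)) i)"
  have coeff: "coeff p i = (if i \<le> N then c i else 0)" for i
    by (simp add: p_def coeff_sum)
  have p: "p \<noteq> 0" using c(1) coeff by (metis coeff_0 of_real_eq_0_iff)
  have deg: "degree p \<le> N" by (rule degree_le) (simp add: coeff)
  have "(\<Sum>i\<le>degree p. coeff p i * complex_of_real (u \<bullet> (A ^^ i) x)) = 0" for x
  proof -
    have "(\<Sum>i\<le>degree p. coeff p i * complex_of_real (u \<bullet> (A ^^ i) x))
        = (\<Sum>i\<le>N. coeff p i * complex_of_real (u \<bullet> (A ^^ i) x))"
      using deg by (intro sum.mono_neutral_left) (auto simp: coeff_eq_0)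
    also have "\<dots> = of_real (\<Sum>i\<le>N. c i * (u \<bullet> (A ^^ i) x))" by (simp add: coeff)
    finally show ?thesis by (simp add: rel)
  qed
  moreover have "linear (\<lambda>x. complex_of_real (u \<bullet> x))"
    by (simp add: linear_iff inner_add_right scaleR_conv_of_real)
  ultimately have "dominated A (\<lambda>x. (cmod (complex_of_real (u \<bullet> x)))\<^sup>2)"
    using dominated_annihilated[OF A hurwitz _ p, of "\<lambda>x. complex_of_real (u \<bullet> x)"] by blast
  then show ?thesis by simp
qed

text \<open>Adding the forms obtained for the coordinate functionals gives a definite one.\<close>

lemma hurwitz_lyapunov:
  fixes A :: "'a::euclidean_space \<Rightarrow> 'a"
  assumes A: "linear A"
    and hurwitz: "left_hurwitz A"
  obtains \<beta> c where "bounded_bilinear \<beta>" "\<And>x y. \<beta> x y = \<beta> y x"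
    "\<And>x. (norm x)\<^sup>2 \<le> \<beta> x x" "0 < c" "\<And>x. \<beta> x (A x) \<le> - c * (norm x)\<^sup>2"
proof -
  have "dominated A (\<lambda>x. \<Sum>b\<in>S. (b \<bullet> x)\<^sup>2)" if "finite S" for S
    using that
  proof (induction S rule: finite_induct)
    case (insert b S)
    then show ?case
      using dominated_add[OF dominated_inner[OF A hurwitz, where u = b] insert.IH] by simp
  qed (simp add: dominated_zero)
  from this[OF finite_Basis]
  obtain \<beta> c where \<beta>: "bilinear \<beta>" "\<And>x y. \<beta> x y = \<beta> y x"
      "\<And>x. (\<Sum>b\<in>Basis. (b \<bullet> x)\<^sup>2) \<le> \<beta> x x" "0 < c" "\<And>x. \<beta> x (A x) \<le> - c * \<beta> x x"
    unfolding dominated_def by blast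
  have n: "(norm x)\<^sup>2 \<le> \<beta> x x" for x
    using \<beta>(3)[of x] unfolding power2_norm_eq_inner
    by (subst euclidean_inner) (simp add: power2_eq_square inner_commute)
  have "\<beta> x (A x) \<le> - c * (norm x)\<^sup>2" for x
    using \<beta>(5)[of x] mult_left_mono[OF n[of x], of c] \<beta>(4) by linarith
  then show ?thesis
    using that[of \<beta> c] \<beta> n by (simp add: bilinear_conv_bounded_bilinear)
qed


section \<open>Spectra of second and third order systems\<close>

text \<open>A nonzero functional annihilating the columns of a matrix makes it singular, and singularity then provides a
right eigenvector. This is the passage between the left eigenvectors of \<open>left_hurwitz\<close> and the eigenvalue
conditions imposed on the gains.\<close>

lemma det_zero_if_left_kernel:
  fixes f :: "real^'n \<Rightarrow> complex" and C :: "complex^'n^'n"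
  assumes f: "linear f" "f x \<noteq> 0"
    and C: "\<And>j. (\<Sum>i\<in>UNIV. C $ i $ j * f (axis i 1)) = 0"
  shows "det C = 0"
proof (rule ccontr)
  assume "det C \<noteq> 0"
  then have "invertible (transpose C)" by (simp add: invertible_det_nz)
  then obtain B where B: "B ** transpose C = mat 1" by (auto simp: invertible_def)
  let ?w = "(\<chi> i. f (axis i 1)) :: complex^'n"
  have "transpose C *v ?w = 0"
    using C by (simp add: transpose_def matrix_vector_mult_def vec_eq_iff)
  then have "B *v (transpose C *v ?w) = 0" by (simp only: matrix_vector_mult_0_right)
  then have "mat 1 *v ?w = 0" by (simp only: matrix_vector_mul_assoc B)
  then have "?w = 0" by simp
  then have "f (axis i 1) = 0" for i by (simp add: vec_eq_iff)
  moreover have "x = (\<Sum>i\<in>UNIV. x $ i *\<^sub>R axis i 1)"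
    using basis_expansion[of x] by (simp add: scalar_mult_eq_scaleR)
  then have "f x = (\<Sum>i\<in>UNIV. x $ i *\<^sub>R f (axis i 1))"
    by (metis (no_types, lifting) f(1) linear_scale linear_sum sum.cong)
  ultimately show False using f(2) by simp
qed

lemma linear_matrix_axis:
  fixes f :: "real^'n \<Rightarrow> complex" and M :: "real^'k^'n"
  assumes "linear f"
  shows "f (M *v axis j 1) = (\<Sum>i\<in>UNIV. complex_of_real (M $ i $ j) * f (axis i 1))"
proof -
  have "M *v axis j 1 = (\<Sum>i\<in>UNIV. (M $ i $ j) *\<^sub>R (axis i 1 :: real^'n))"
    using basis_expansion[of "column j M"]
    by (simp add: matrix_vector_mul_component column_def scalar_mult_eq_scaleR matrix_vector_mult_basis)
  then show ?thesis
    by (simp only: linear_sum[OF assms] linear_scale[OF assms]) (simp add: scaleR_conv_of_real)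
qed

definition quadratic_pencil :: "real^3^3 \<Rightarrow> real^3^3 \<Rightarrow> complex \<Rightarrow> complex^3^3" where
  "quadratic_pencil KP KD z = (\<chi> i j. (if i = j then z\<^sup>2 else 0)
     + z * complex_of_real (KD $ i $ j) + complex_of_real (KP $ i $ j))"

text \<open>The block matrix is the companion matrix of the pencil: a kernel vector \<open>v\<close> of the pencil at \<open>z\<close> gives the
eigenvector \<open>(v, z v)\<close>.\<close>

lemma hurwitz_block_quadratic_pencil:
  fixes KP KD :: "real^3^3"
  assumes hurwitz: "hurwitz_matrix (block_matrix 0 (mat 1) (- KP) (- KD))"
    and det: "det (quadratic_pencil KP KD z) = 0"
  shows "Re z < 0"
proof -
  let ?C = "quadratic_pencil KP KD z"
  have "\<not> invertible ?C" using det by (simp add: invertible_det_nz)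
  then obtain v where v: "v \<noteq> 0" "?C *v v = 0"
    by (metis invertible_left_inverse matrix_left_invertible_ker)
  let ?x = "(\<chi> i. case i of Inl k \<Rightarrow> v $ k | Inr k \<Rightarrow> z * v $ k) :: complex^(3 + 3)"
  have row: "z\<^sup>2 * v $ k + (\<Sum>j\<in>UNIV. z * complex_of_real (KD $ k $ j) * v $ j)
      + (\<Sum>j\<in>UNIV. complex_of_real (KP $ k $ j) * v $ j) = 0" for k
  proof -
    have "(?C *v v) $ k = 0" using v by simp
    moreover have "(?C *v v) $ k = (\<Sum>j\<in>UNIV. (if k = j then z\<^sup>2 * v $ j else 0)
        + z * complex_of_real (KD $ k $ j) * v $ j + complex_of_real (KP $ k $ j) * v $ j)"
      unfolding matrix_vector_mult_def quadratic_pencil_def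
      by (auto intro!: sum.cong simp: algebra_simps)
    ultimately show ?thesis by (simp add: sum.distrib)
  qed
  have "complex_matrix (block_matrix 0 (mat 1) (- KP) (- KD)) *v ?x = z *s ?x"
  proof (subst vec_eq_iff, intro allI)
    fix i :: "3 + 3"
    have split: "(\<Sum>j\<in>UNIV. h j) = (\<Sum>j\<in>UNIV. h (Inl j)) + (\<Sum>j\<in>UNIV. h (Inr j))"
      for h :: "3 + 3 \<Rightarrow> complex"
      unfolding UNIV_Plus_UNIV[symmetric] by (subst sum.Plus) auto
    show "(complex_matrix (block_matrix 0 (mat 1) (- KP) (- KD)) *v ?x) $ i = (z *s ?x) $ i"
    proof (cases i)
      case (Inl k)
      then show ?thesis
        by (simp add: matrix_vector_mult_def complex_matrix_def block_matrix_def split mat_def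
            if_distrib[of complex_of_real] if_distrib[of "\<lambda>a. a * _"] cong: if_cong)
    next
      case (Inr k)
      have "- (\<Sum>j\<in>UNIV. complex_of_real (KP $ k $ j) * v $ j)
          - (\<Sum>j\<in>UNIV. z * complex_of_real (KD $ k $ j) * v $ j) = z\<^sup>2 * v $ k"
        using row[of k] by algebra
      then show ?thesis using Inr
        by (simp add: matrix_vector_mult_def complex_matrix_def block_matrix_def split
            sum_negf power2_eq_square mult_ac)
    qed
  qed
  moreover have "?x \<noteq> 0"
  proof
    assume "?x = 0"
    then have "?x $ Inl k = 0" for k by simp
    then show False using v(1) by (simp add: vec_eq_iff)
  qed
  ultimately show ?thesis using hurwitz unfolding hurwitz_matrix_def eigenvalues_def by blast
qed

text \<open>The block equations of a left eigenvector \<open>m\<close> determine its first block \<open>g\<close> from its last block \<open>f\<close> and leave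
the statement that \<open>f\<close> is a left kernel functional of the pencil.\<close>

lemma left_hurwitz_PD:
  fixes KP KD :: "real^3^3"
  assumes "hurwitz_matrix (block_matrix 0 (mat 1) (- KP) (- KD))"
  shows "left_hurwitz (\<lambda>x. (snd x, - (KP *v fst x) - KD *v snd x))"
  unfolding left_hurwitz_def
proof (intro allI impI)
  fix m :: "(real^3) \<times> (real^3) \<Rightarrow> complex" and z
  assume m: "linear m"
    and eig: "\<forall>x. m (snd x, - (KP *v fst x) - KD *v snd x) = z * m x"
    and nz: "\<exists>x. m x \<noteq> 0"
  define f where "f y = m (0, y)" for y
  define g where "g x = m (x, 0)" for x
  have f: "linear f" and g: "linear g"
    unfolding f_def g_def
    using linear_compose[OF _ m, of "\<lambda>y. (0, y)"] linear_compose[OF _ m, of "\<lambda>x. (x, 0)"]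
    by (simp_all add: o_def linear_iff[of "Pair 0"] linear_iff[of "\<lambda>x. (x, 0)"])
  have split: "m (x, y) = g x + f y" for x y
    using linear_add[OF m, of "(x, 0)" "(0, y)"] by (simp add: f_def g_def)
  have 1: "f (KP *v x) = - (z * g x)" for x
    using eig[rule_format, of "(x, 0)"] linear_neg[OF f, of "KP *v x"] linear_0[OF f] linear_0[OF g]
    by (simp add: split) (metis minus_minus)
  have 2: "g y = f (KD *v y) + z * f y" for y
    using eig[rule_format, of "(0, y)"] linear_neg[OF f, of "KD *v y"] linear_0[OF g]
    by (simp add: split algebra_simps)
  have char: "z\<^sup>2 * f y + z * f (KD *v y) + f (KP *v y) = 0" for y
    by (simp add: 1 2 power2_eq_square algebra_simps)
  have "\<exists>y. f y \<noteq> 0"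
  proof (rule ccontr)
    assume "\<not> ?thesis"
    then have f0: "f y = 0" for y by blast
    then have "g y = 0" for y by (simp add: 2)
    then have "m (x, y) = 0" for x y by (simp add: split f0)
    then show False using nz by auto
  qed
  then obtain y where y: "f y \<noteq> 0" by blast
  have "det (quadratic_pencil KP KD z) = 0"
  proof (rule det_zero_if_left_kernel[OF f y])
    fix j
    have "(\<Sum>i\<in>UNIV. quadratic_pencil KP KD z $ i $ j * f (axis i 1))
        = (\<Sum>i\<in>UNIV. (if i = j then z\<^sup>2 * f (axis i 1) else 0)
            + z * (complex_of_real (KD $ i $ j) * f (axis i 1)) + complex_of_real (KP $ i $ j) * f (axis i 1))"
      by (intro sum.cong) (auto simp: quadratic_pencil_def algebra_simps)
    also have "\<dots> = z\<^sup>2 * f (axis j 1) + z * f (KD *v axis j 1) + f (KP *v axis j 1)"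
      by (simp add: sum.distrib linear_matrix_axis[OF f] sum_distrib_left)
    finally show "(\<Sum>i\<in>UNIV. quadratic_pencil KP KD z $ i $ j * f (axis i 1)) = 0"
      by (simp add: char)
  qed
  then show "Re z < 0" by (rule hurwitz_block_quadratic_pencil[OF assms])
qed

lemma poly_of_real_add:
  "poly (map_poly complex_of_real (p + q)) z
     = poly (map_poly complex_of_real p) z + poly (map_poly complex_of_real q) z"
proof -
  have "map_poly complex_of_real (p + q) = map_poly complex_of_real p + map_poly complex_of_real q"
    by (rule poly_eqI) (simp add: coeff_map_poly)
  then show ?thesis by simp
qed

lemma poly_of_real_minus:
  "poly (map_poly complex_of_real (p - q)) z
     = poly (map_poly complex_of_real p) z - poly (map_poly complex_of_real q) z"
  using poly_of_real_add[of "p - q" q z] by simp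

lemma poly_of_real_mult:
  "poly (map_poly complex_of_real (p * q)) z
     = poly (map_poly complex_of_real p) z * poly (map_poly complex_of_real q) z"
proof -
  have "map_poly complex_of_real (p * q) = map_poly complex_of_real p * map_poly complex_of_real q"
    by (rule poly_eqI) (simp add: coeff_map_poly coeff_mult)
  then show ?thesis by simp
qed

lemma poly_of_real_monom:
  "poly (map_poly complex_of_real (monom a n)) z = complex_of_real a * z ^ n"
  by (simp add: map_poly_monom poly_monom)

lemma poly_pid_poly:
  fixes KP KD KI :: "real^3^3"
  shows "poly (map_poly complex_of_real (pid_poly KP KD KI)) z
    = det (\<chi> i j. (if i = j then z ^ 3 else 0) + z\<^sup>2 * complex_of_real (KD $ i $ j)
        + z * complex_of_real (KP $ i $ j) + complex_of_real (KI $ i $ j))"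
  unfolding pid_poly_def det_3
  by (simp add: poly_of_real_add poly_of_real_minus poly_of_real_mult poly_of_real_monom mat_def mult.commute)

text \<open>The elimination is the same as for the second order system, with the integral of the error as an additional
first block; the remaining cubic pencil has the determinant \<open>pid_poly\<close>.\<close>

lemma left_hurwitz_PID:
  fixes KP KD KI :: "real^3^3"
  assumes "hurwitz_poly (pid_poly KP KD KI)"
  shows "left_hurwitz (\<lambda>x. (fst (snd x), snd (snd x),
    - (KI *v fst x) - KP *v fst (snd x) - KD *v snd (snd x)))"
  unfolding left_hurwitz_def
proof (intro allI impI)
  fix m :: "(real^3) \<times> (real^3) \<times> (real^3) \<Rightarrow> complex" and z
  assume m: "linear m"
    and eig: "\<forall>x. m (fst (snd x), snd (snd x),
      - (KI *v fst x) - KP *v fst (snd x) - KD *v snd (snd x)) = z * m x"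
    and nz: "\<exists>x. m x \<noteq> 0"
  define f where "f y = m (0, 0, y)" for y
  define g where "g x = m (0, x, 0)" for x
  define h where "h w = m (w, 0, 0)" for w
  have f: "linear f" and g: "linear g" and h: "linear h"
    unfolding f_def g_def h_def
    using linear_compose[OF _ m, of "\<lambda>y. (0, 0, y)"] linear_compose[OF _ m, of "\<lambda>x. (0, x, 0)"]
      linear_compose[OF _ m, of "\<lambda>w. (w, 0, 0)"]
    by (simp_all add: o_def linear_iff[of "\<lambda>y. (0, 0, y)"] linear_iff[of "\<lambda>x. (0, x, 0)"]
        linear_iff[of "\<lambda>w. (w, 0, 0)"])
  have split: "m (w, x, y) = h w + g x + f y" for w x y
    using linear_add[OF m, of "(w, 0, 0)" "(0, x, y)"] linear_add[OF m, of "(0, x, 0)" "(0, 0, y)"]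
    by (simp add: f_def g_def h_def)
  note zero = linear_0[OF f] linear_0[OF g] linear_0[OF h]
  have 1: "f (KI *v w) = - (z * h w)" for w
    using eig[rule_format, of "(w, 0, 0)"] linear_neg[OF f, of "KI *v w"]
    by (simp add: split zero) (metis minus_minus)
  have 2: "h x = f (KP *v x) + z * g x" for x
    using eig[rule_format, of "(0, x, 0)"] linear_neg[OF f, of "KP *v x"]
    by (simp add: split zero algebra_simps)
  have 3: "g y = f (KD *v y) + z * f y" for y
    using eig[rule_format, of "(0, 0, y)"] linear_neg[OF f, of "KD *v y"]
    by (simp add: split zero algebra_simps)
  have char: "z ^ 3 * f y + z\<^sup>2 * f (KD *v y) + z * f (KP *v y) + f (KI *v y) = 0" for y
    by (simp add: 1 2 3 power2_eq_square power3_eq_cube algebra_simps)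
  have "\<exists>y. f y \<noteq> 0"
  proof (rule ccontr)
    assume "\<not> ?thesis"
    then have f0: "f y = 0" for y by blast
    then have g0: "g y = 0" for y by (simp add: 3)
    have "h y = 0" for y by (simp add: 2 f0 g0)
    then have "m (w, x, y) = 0" for w x y by (simp add: split f0 g0)
    then show False using nz by auto
  qed
  then obtain y where y: "f y \<noteq> 0" by blast
  let ?C = "(\<chi> i j. (if i = j then z ^ 3 else 0) + z\<^sup>2 * complex_of_real (KD $ i $ j)
        + z * complex_of_real (KP $ i $ j) + complex_of_real (KI $ i $ j)) :: complex^3^3"
  have "det ?C = 0"
  proof (rule det_zero_if_left_kernel[OF f y])
    fix j
    have "(\<Sum>i\<in>UNIV. ?C $ i $ j * f (axis i 1))
        = (\<Sum>i\<in>UNIV. (if i = j then z ^ 3 * f (axis i 1) else 0)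
            + z\<^sup>2 * (complex_of_real (KD $ i $ j) * f (axis i 1))
            + z * (complex_of_real (KP $ i $ j) * f (axis i 1)) + complex_of_real (KI $ i $ j) * f (axis i 1))"
      by (intro sum.cong) (auto simp: algebra_simps)
    also have "\<dots> = z ^ 3 * f (axis j 1) + z\<^sup>2 * f (KD *v axis j 1) + z * f (KP *v axis j 1) + f (KI *v axis j 1)"
      by (simp add: sum.distrib linear_matrix_axis[OF f] sum_distrib_left)
    finally show "(\<Sum>i\<in>UNIV. ?C $ i $ j * f (axis i 1)) = 0"
      by (simp add: char)
  qed
  then show "Re z < 0"
    using assms unfolding hurwitz_poly_def by (simp only: poly_pid_poly)
qed


section \<open>Definite quadratic forms and symmetric matrices\<close>

lemma quadratic_form_coercive:
  fixes p q s :: real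
  assumes "0 < p" "0 < q" "s\<^sup>2 < 4 * p * q"
  obtains c where "0 < c" "\<And>x y. c * (x\<^sup>2 + y\<^sup>2) \<le> p * x\<^sup>2 + q * y\<^sup>2 - s * x * y"
proof -
  define c where "c = (4 * p * q - s\<^sup>2) / (4 * (p + q))"
  have c: "0 < c" using assms by (simp add: c_def)
  have "c * (4 * (p + q)) = 4 * p * q - s\<^sup>2"
    using assms nonzero_eq_divide_eq[of "4 * (p + q)" c "4 * p * q - s\<^sup>2"] c_def by simp
  then have cpq: "4 * c * (p + q) = 4 * p * q - s\<^sup>2" by (simp add: algebra_simps)
  have "c * (p + q) \<le> p * q" using cpq zero_le_power2[of s] by linarith
  moreover have "p * q < p * (p + q)" using assms by simp
  ultimately have "c * (p + q) < p * (p + q)" by linarith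
  then have pc: "0 < p - c" using assms by (simp add: mult_less_cancel_right)
  have "c * (x\<^sup>2 + y\<^sup>2) \<le> p * x\<^sup>2 + q * y\<^sup>2 - s * x * y" for x y
  proof -
    let ?d = "p * x\<^sup>2 + q * y\<^sup>2 - s * x * y - c * (x\<^sup>2 + y\<^sup>2)"
    have "4 * ((p - c) * (q - c)) - s\<^sup>2 = 4 * c\<^sup>2"
      using cpq by (simp add: power2_eq_square algebra_simps)
    then have "0 \<le> 4 * ((p - c) * (q - c)) - s\<^sup>2" by simp
    then have "0 \<le> (4 * ((p - c) * (q - c)) - s\<^sup>2) * y\<^sup>2" by (intro mult_nonneg_nonneg) auto
    moreover have "4 * (p - c) * ?d
        = (2 * (p - c) * x - s * y)\<^sup>2 + (4 * ((p - c) * (q - c)) - s\<^sup>2) * y\<^sup>2"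
      by (simp add: power2_eq_square algebra_simps)
    ultimately have "0 \<le> 4 * (p - c) * ?d" by (metis add_nonneg_nonneg zero_le_power2)
    then have "0 \<le> ?d" using pc by (simp add: zero_le_mult_iff)
    then show ?thesis by simp
  qed
  with c show ?thesis by (rule that)
qed

lemma sym_inner_matrix:
  fixes A :: "real^'n^'n"
  assumes "transpose A = A"
  shows "v \<bullet> (A *v w) = w \<bullet> (A *v v)"
  by (metis assms dot_lmul_matrix inner_commute transpose_matrix_vector)

lemma discriminant_nonpos:
  fixes a b c :: real
  assumes quad: "\<And>t. 0 \<le> a + 2 * t * b + t\<^sup>2 * c" and c: "0 \<le> c"
  shows "b\<^sup>2 \<le> a * c"
proof (cases "c = 0")
  case True
  have "b = 0"
  proof (rule ccontr)
    assume b: "b \<noteq> 0"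
    then have "2 * (- (a + 1) / (2 * b)) * b = - (a + 1)" by (simp add: field_simps)
    then show False using quad[of "- (a + 1) / (2 * b)"] True by simp
  qed
  then show ?thesis using True by simp
next
  case False
  have "2 * (- b / c) * b + (- b / c)\<^sup>2 * c = - (b\<^sup>2 / c)"
    using False by (simp add: power2_eq_square field_simps)
  then have "b\<^sup>2 / c \<le> a" using quad[of "- b / c"] by simp
  then show ?thesis using False c by (simp add: field_simps)
qed

lemma psd_cauchy_schwarz:
  fixes A :: "real^'n^'n"
  assumes sym: "transpose A = A" and psd: "\<And>v. 0 \<le> v \<bullet> (A *v v)"
  shows "(w \<bullet> (A *v v))\<^sup>2 \<le> (v \<bullet> (A *v v)) * (w \<bullet> (A *v w))"
proof -
  let ?a = "v \<bullet> (A *v v)" and ?b = "w \<bullet> (A *v v)" and ?c = "w \<bullet> (A *v w)"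
  have quad: "0 \<le> ?a + 2 * t * ?b + t\<^sup>2 * ?c" for t
  proof -
    have "(v + t *\<^sub>R w) \<bullet> (A *v (v + t *\<^sub>R w)) = ?a + t * ?b + t * (v \<bullet> (A *v w)) + t\<^sup>2 * ?c"
      by (simp add: matrix_vector_right_distrib matrix_vector_mult_scaleR inner_add_left
          inner_add_right power2_eq_square algebra_simps)
    then show ?thesis using psd[of "v + t *\<^sub>R w"] sym_inner_matrix[OF sym, of v w] by simp
  qed
  show ?thesis using quad psd[of w] by (rule discriminant_nonpos)
qed

lemma matrix_minus_vector: "(- A) *v v = - (A *v v)" for A :: "real^'n^'m"
  by (simp add: matrix_vector_mult_def vec_eq_iff sum_negf)

text \<open>The minimum of the quadratic form on the unit sphere is attained, and a minimiser is an eigenvector: for the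
shifted matrix \<open>A - m I\<close>, whose form is positive semidefinite, the Cauchy-Schwarz inequality shows that a
zero of the form lies in the kernel.\<close>

lemma rayleigh_min:
  fixes A :: "real^'n^'n"
  assumes sym: "transpose A = A"
  obtains m v where "v \<noteq> 0" "A *v v = m *\<^sub>R v" "\<And>w. m * (norm w)\<^sup>2 \<le> w \<bullet> (A *v w)"
proof -
  have "axis undefined 1 \<in> sphere (0 :: real^'n) 1" by simp
  then have ne: "sphere (0 :: real^'n) 1 \<noteq> {}" by blast
  have cont: "continuous_on (sphere 0 1) (\<lambda>v. v \<bullet> (A *v v))"
    by (intro continuous_intros linear_continuous_on) simp
  obtain v where v: "v \<in> sphere 0 1" "\<And>w. w \<in> sphere 0 1 \<Longrightarrow> v \<bullet> (A *v v) \<le> w \<bullet> (A *v w)"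
    using continuous_attains_inf[OF compact_sphere ne cont] by auto
  define m where "m = v \<bullet> (A *v v)"
  have low: "m * (norm w)\<^sup>2 \<le> w \<bullet> (A *v w)" for w
  proof (cases "w = 0")
    case False
    let ?u = "(1 / norm w) *\<^sub>R w"
    have "m \<le> ?u \<bullet> (A *v ?u)" unfolding m_def using False by (intro v(2)) simp
    also have "\<dots> = (w \<bullet> (A *v w)) / (norm w)\<^sup>2"
      by (simp add: matrix_vector_mult_scaleR power2_eq_square)
    finally show ?thesis using False by (simp add: field_simps)
  qed simp
  let ?B = "A - m *\<^sub>R mat 1"
  have Bw: "?B *v w = A *v w - m *\<^sub>R w" for w
    by (simp add: matrix_vector_mult_diff_rdistrib scaleR_matrix_vector_assoc[symmetric])
  have "transpose ?B = ?B"
    using sym by (auto simp: transpose_def vec_eq_iff mat_def)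
  moreover have "0 \<le> w \<bullet> (?B *v w)" for w
    using low[of w] by (simp add: Bw inner_diff_right power2_norm_eq_inner)
  ultimately have "(w \<bullet> (?B *v v))\<^sup>2 \<le> (v \<bullet> (?B *v v)) * (w \<bullet> (?B *v w))" for w
    by (rule psd_cauchy_schwarz)
  moreover have "v \<bullet> (?B *v v) = 0"
    using v(1) unfolding Bw inner_diff_right by (simp add: m_def dot_square_norm)
  ultimately have "w \<bullet> (?B *v v) = 0" for w by simp
  then have "?B *v v = 0" by (metis inner_eq_zero_iff)
  then have "A *v v = m *\<^sub>R v" by (simp add: Bw)
  moreover have "v \<noteq> 0" using v(1) by auto
  ultimately show ?thesis using low by (intro that)
qed

text \<open>Finiteness is what makes \<open>Min\<close> and \<open>Max\<close> in \<open>lambda_min\<close> and \<open>lambda_max\<close> meaningful. Eigenvectors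
for distinct eigenvalues are orthogonal, hence independent.\<close>

lemma finite_eigenvalues_symmetric:
  fixes A :: "real^'n^'n"
  assumes sym: "transpose A = A"
  shows "finite (eigenvalues A)"
proof -
  have "\<forall>l \<in> eigenvalues A. \<exists>v. v \<noteq> 0 \<and> A *v v = l *\<^sub>R v"
    by (auto simp: eigenvalues_def scalar_mult_eq_scaleR)
  then obtain f where f: "\<And>l. l \<in> eigenvalues A \<Longrightarrow> f l \<noteq> 0 \<and> A *v f l = l *\<^sub>R f l"
    by (metis bchoice)
  have orth: "f l \<bullet> f k = 0" if "l \<in> eigenvalues A" "k \<in> eigenvalues A" "l \<noteq> k" for l k
  proof -
    have "l * (f l \<bullet> f k) = k * (f l \<bullet> f k)"
      using sym_inner_matrix[OF sym, of "f k" "f l"] f that by (simp add: inner_commute)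
    then show ?thesis using that by simp
  qed
  have inj: "inj_on f (eigenvalues A)"
    by (rule inj_onI) (metis f inner_eq_zero_iff orth)
  have "independent (f ` eigenvalues A)"
  proof (rule pairwise_orthogonal_independent)
    show "pairwise orthogonal (f ` eigenvalues A)"
      using orth by (auto simp: pairwise_def orthogonal_def)
    show "0 \<notin> f ` eigenvalues A" using f by force
  qed
  then have "finite (f ` eigenvalues A)" by (rule finiteI_independent)
  then show ?thesis using inj by (rule finite_imageD)
qed

lemma sym_pos_def_bounds:
  fixes A :: "real^'n^'n"
  assumes "sym_pos_def A"
  shows "0 < lambda_min A" "0 < lambda_max A"
    "lambda_min A * (norm v)\<^sup>2 \<le> v \<bullet> (A *v v)" "norm (A *v v) \<le> lambda_max A * norm v"
proof -
  have sym: "transpose A = A" and pos: "\<And>v. v \<noteq> 0 \<Longrightarrow> 0 < v \<bullet> (A *v v)"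
    using assms by (auto simp: sym_pos_def_def)
  have psd: "0 \<le> w \<bullet> (A *v w)" for w
    using pos[of w] by (cases "w = 0") (auto intro: less_imp_le)
  note fin = finite_eigenvalues_symmetric[OF sym]
  have pos_eig: "0 < l" if l: "l \<in> eigenvalues A" for l
  proof -
    obtain u where u: "u \<noteq> 0" "A *v u = l *\<^sub>R u"
      using l by (auto simp: eigenvalues_def scalar_mult_eq_scaleR)
    then have "0 < l * (u \<bullet> u)" using pos[of u] by simp
    then show ?thesis using u by (metis inner_gt_zero_iff zero_less_mult_pos2)
  qed
  obtain m u where m: "u \<noteq> 0" "A *v u = m *\<^sub>R u" "\<And>w. m * (norm w)\<^sup>2 \<le> w \<bullet> (A *v w)"
    using rayleigh_min[OF sym] by blast
  have m_eig: "m \<in> eigenvalues A" using m by (auto simp: eigenvalues_def scalar_mult_eq_scaleR)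
  have ne: "eigenvalues A \<noteq> {}" using m_eig by auto
  show min: "0 < lambda_min A" using pos_eig Min_in[OF fin ne] by (simp add: lambda_min_def)
  show max: "0 < lambda_max A" using pos_eig Max_in[OF fin ne] by (simp add: lambda_max_def)
  have "lambda_min A \<le> m" using Min_le[OF fin m_eig] by (simp add: lambda_min_def)
  then show "lambda_min A * (norm v)\<^sup>2 \<le> v \<bullet> (A *v v)"
    using m(3)[of v] by (meson mult_right_mono order_trans zero_le_power2)
  have sym': "transpose (- A) = - A"
    using sym by (auto simp: transpose_def vec_eq_iff)
  obtain k y where k: "y \<noteq> 0" "(- A) *v y = k *\<^sub>R y" "\<And>w. k * (norm w)\<^sup>2 \<le> w \<bullet> ((- A) *v w)"
    by (rule rayleigh_min[OF sym']) (rule that)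
  have "A *v y = (- k) *\<^sub>R y" using k(2) minus_equation_iff[of "A *v y" "k *\<^sub>R y"] by (simp add: matrix_minus_vector)
  then have "- k \<in> eigenvalues A" using k(1) by (auto simp: eigenvalues_def scalar_mult_eq_scaleR)
  then have kmax: "- k \<le> lambda_max A" using Max_ge[OF fin] by (simp add: lambda_max_def)
  have up: "w \<bullet> (A *v w) \<le> lambda_max A * (norm w)\<^sup>2" for w
  proof -
    have "w \<bullet> (A *v w) \<le> - k * (norm w)\<^sup>2" using k(3)[of w] by (simp add: matrix_minus_vector)
    also have "\<dots> \<le> lambda_max A * (norm w)\<^sup>2" using kmax by (intro mult_right_mono) auto
    finally show ?thesis .
  qed
  show "norm (A *v v) \<le> lambda_max A * norm v"
  proof (cases "A *v v = 0")
    case True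
    then show ?thesis using max by simp
  next
    case False
    let ?w = "A *v v"
    \<comment> \<open>The operator norm is bounded by Cauchy-Schwarz for the form of \<open>A\<close>, tested against \<open>w = A v\<close>.\<close>
    have "(norm ?w)\<^sup>2 * (norm ?w)\<^sup>2 = (?w \<bullet> (A *v v))\<^sup>2" by (simp add: dot_square_norm power2_eq_square)
    also have "\<dots> \<le> (v \<bullet> (A *v v)) * (?w \<bullet> (A *v ?w))" by (rule psd_cauchy_schwarz[OF sym psd])
    also have "\<dots> \<le> (lambda_max A * (norm v)\<^sup>2) * (lambda_max A * (norm ?w)\<^sup>2)"
      by (intro mult_mono up psd) (use max in auto)
    finally have "(norm ?w)\<^sup>2 * (norm ?w)\<^sup>2 \<le> (lambda_max A * norm v)\<^sup>2 * (norm ?w)\<^sup>2"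
      by (simp only: power2_eq_square mult_ac)
    then have "(norm ?w)\<^sup>2 \<le> (lambda_max A * norm v)\<^sup>2"
      by (rule mult_right_le_imp_le) (use False in simp)
    then show ?thesis by (rule power2_le_imp_le) (use max in simp)
  qed
qed


section \<open>Attitude error kinematics\<close>

lemma bounded_bilinear_matrix_mult:
  "bounded_bilinear ((**) :: real^'n^'m \<Rightarrow> real^'k^'n \<Rightarrow> real^'k^'m)"
  unfolding bilinear_conv_bounded_bilinear[symmetric] bilinear_def linear_iff
  by (simp add: matrix_matrix_mult_def vec_eq_iff sum.distrib sum_distrib_left algebra_simps)

lemma linear_transpose: "linear (transpose :: real^'n^'m \<Rightarrow> real^'m^'n)"
  by (simp add: linear_iff transpose_def vec_eq_iff)

lemma linear_hat: "linear hat"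
  by (simp add: linear_iff hat_def vec_eq_iff forall_3 vector_3)

text \<open>On skew-symmetric matrices this is \<open>vee\<close>; composing with the projection onto them gives a map that is
linear on all matrices and can be differentiated and estimated as such.\<close>

definition axial :: "real^3^3 \<Rightarrow> real^3" where
  "axial M = vee (skew_part M)"

lemma hat_axial: "hat (axial M) = skew_part M"
  unfolding axial_def
  by (rule hat_vee) (simp add: skew_part_def transpose_def vec_eq_iff field_simps)

lemma axial_components:
  "axial M = vector [(M$3$2 - M$2$3) / 2, (M$1$3 - M$3$1) / 2, (M$2$1 - M$1$2) / 2]"
proof -
  have "skew_part M = hat (vector [(M$3$2 - M$2$3) / 2, (M$1$3 - M$3$1) / 2, (M$2$1 - M$1$2) / 2])"
    by (simp add: skew_part_def transpose_def hat_def vec_eq_iff forall_3 vector_3 field_simps)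
  then show ?thesis by (simp add: axial_def)
qed

lemma linear_axial: "linear axial"
  by (simp add: linear_iff axial_components vec_eq_iff forall_3 vector_3 field_simps)

text \<open>With \<open>E = R0\<^sup>T R = I + F\<close> the relative attitude satisfies \<open>E' = E (hat w) - (hat w0) E\<close>. The first two terms on
the right-hand side form the linearisation at \<open>F = 0\<close>, the commutator of \<open>F\<close> with \<open>hat w0\<close> being exactly a cross
product, and the last term is quadratic in the error.\<close>

lemma axial_error_rate:
  "axial ((mat 1 + F) ** hat w - hat w0 ** (mat 1 + F))
     = axial F \<times> w0 + (w - w0) + axial (F ** hat (w - w0))"
  by (simp add: axial_components hat_def matrix_matrix_mult_def mat_def cross3_def
      vec_eq_iff forall_3 vector_3 sum_3) (simp add: field_simps)

lemma norm_orthogonal_matrix_mult: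
  fixes Q :: "real^'n^'n" and M :: "real^'m^'n"
  assumes "orthogonal_matrix Q"
  shows "norm (Q ** M) = norm M"
proof -
  have tr: "M \<bullet> M = trace (transpose M ** M)" for M :: "real^'m^'n"
  proof -
    have "M \<bullet> M = (\<Sum>i\<in>UNIV. \<Sum>j\<in>UNIV. M $ i $ j * M $ i $ j)" by (simp add: inner_vec_def)
    also have "\<dots> = (\<Sum>j\<in>UNIV. \<Sum>i\<in>UNIV. M $ i $ j * M $ i $ j)" by (rule sum.swap)
    finally show ?thesis by (simp add: trace_def matrix_matrix_mult_def transpose_def)
  qed
  have "transpose (Q ** M) ** (Q ** M) = transpose M ** ((transpose Q ** Q) ** M)"
    by (simp add: matrix_transpose_mul matrix_mul_assoc)
  also have "\<dots> = transpose M ** M" using assms by (simp add: orthogonal_matrix_def)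
  finally show ?thesis by (simp add: norm_eq_sqrt_inner tr)
qed

lemma SO3_orthogonal: "R \<in> SO3 \<Longrightarrow> transpose R ** R = mat 1" "R \<in> SO3 \<Longrightarrow> R ** transpose R = mat 1"
  by (auto simp: SO3_def rotation_matrix_def orthogonal_matrix_def)

lemma Zk_axial: "vee (Zk R0 R) = axial (transpose R0 ** (R - R0))"
  by (simp add: Zk_def axial_def)

lemma relative_attitude:
  assumes "R0 \<in> SO3"
  shows "transpose R0 ** R = mat 1 + transpose R0 ** (R - R0)"
  using SO3_orthogonal(1)[OF assms]
  by (simp add: bounded_bilinear.diff_right[OF bounded_bilinear_matrix_mult])

lemma norm_relative_attitude:
  assumes "R0 \<in> SO3"
  shows "norm (transpose R0 ** M) = norm M"
  by (rule norm_orthogonal_matrix_mult)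
     (use SO3_orthogonal[OF assms] in \<open>simp add: orthogonal_matrix_def\<close>)

text \<open>Near the reference the vector \<open>vee (Zk R0 R)\<close> controls the whole attitude error: orthogonality of \<open>I + F\<close> gives
\<open>F + F\<^sup>T = - F\<^sup>T F\<close>, so the symmetric part of \<open>F\<close> is of second order and \<open>F\<close> is dominated by its skew part.\<close>

lemma attitude_error_estimates:
  obtains K r where "0 < K" "0 < r"
    "\<And>R0 R. R0 \<in> SO3 \<Longrightarrow> norm (vee (Zk R0 R)) \<le> K * norm (R - R0)"
    "\<And>R0 R. R0 \<in> SO3 \<Longrightarrow> R \<in> SO3 \<Longrightarrow> norm (R - R0) \<le> r \<Longrightarrow> norm (R - R0) \<le> K * norm (vee (Zk R0 R))"
    "\<And>R0 R w. R0 \<in> SO3 \<Longrightarrow> norm (axial (transpose R0 ** (R - R0) ** hat w)) \<le> K * norm (R - R0) * norm w"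
proof -
  have "bounded_linear axial" "bounded_linear hat"
    using linear_axial linear_hat by (simp_all only: linear_conv_bounded_linear)
  note this[THEN bounded_linear.pos_bounded]
  then obtain K1 K2 where K1: "0 < K1" "\<And>F. norm (axial F) \<le> norm F * K1"
    and K2: "0 < K2" "\<And>z. norm (hat z) \<le> norm z * K2"
    by metis
  have "bounded_bilinear (\<lambda>F w. axial (F ** hat w))"
    unfolding bilinear_conv_bounded_bilinear[symmetric] bilinear_def linear_iff
    by (simp add: linear_add[OF linear_hat] linear_scale[OF linear_hat]
        linear_add[OF linear_axial] linear_scale[OF linear_axial]
        bounded_bilinear.add_left[OF bounded_bilinear_matrix_mult]
        bounded_bilinear.add_right[OF bounded_bilinear_matrix_mult]
        bounded_bilinear.scaleR_left[OF bounded_bilinear_matrix_mult]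
        bounded_bilinear.scaleR_right[OF bounded_bilinear_matrix_mult])
  then obtain K3 where K3: "0 < K3" "\<And>F w. norm (axial (F ** hat w)) \<le> norm F * norm w * K3"
    using bounded_bilinear.pos_bounded by blast
  have "bounded_bilinear (\<lambda>(F :: real^3^3) (G :: real^3^3). transpose F ** G)"
    unfolding bilinear_conv_bounded_bilinear[symmetric] bilinear_def linear_iff
    by (simp add: linear_add[OF linear_transpose] linear_scale[OF linear_transpose]
        bounded_bilinear.add_left[OF bounded_bilinear_matrix_mult]
        bounded_bilinear.add_right[OF bounded_bilinear_matrix_mult]
        bounded_bilinear.scaleR_left[OF bounded_bilinear_matrix_mult]
        bounded_bilinear.scaleR_right[OF bounded_bilinear_matrix_mult])
  then obtain K4 where K4: "0 < K4" "\<And>(F :: real^3^3) (G :: real^3^3). norm (transpose F ** G) \<le> norm F * norm G * K4"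
    using bounded_bilinear.pos_bounded by blast
  define K where "K = K1 + 2 * K2 + K3"
  have K: "0 < K" "K1 \<le> K" "2 * K2 \<le> K" "K3 \<le> K" using K1 K2 K3 by (auto simp: K_def)
  have near: "norm (R - R0) \<le> K * norm (vee (Zk R0 R))"
    if "R0 \<in> SO3" "R \<in> SO3" "norm (R - R0) \<le> 1 / K4" for R0 R
  proof -
    define F where "F = transpose R0 ** (R - R0)"
    have nF: "norm F = norm (R - R0)" using that by (simp add: F_def norm_relative_attitude)
    have E: "transpose R0 ** R = mat 1 + F" unfolding F_def by (rule relative_attitude[OF that(1)])
    have "transpose (transpose R0 ** R) ** (transpose R0 ** R) = transpose R ** ((R0 ** transpose R0) ** R)"
      by (simp add: matrix_transpose_mul matrix_mul_assoc)
    then have "transpose (mat 1 + F) ** (mat 1 + F) = mat 1"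
      using SO3_orthogonal that E by simp
    then have "transpose F + transpose F ** F = - F"
      by (simp add: linear_add[OF linear_transpose] transpose_mat
          bounded_bilinear.add_left[OF bounded_bilinear_matrix_mult]
          bounded_bilinear.add_right[OF bounded_bilinear_matrix_mult] algebra_simps
          add_eq_0_iff)
    then have sym: "F + transpose F = - (transpose F ** F)"
      by (simp only: eq_neg_iff_add_eq_0 add_ac)
    have "F = skew_part F + (1/2) *\<^sub>R (F + transpose F)"
      by (simp add: skew_part_def scaleR_add_right scaleR_diff_right flip: scaleR_add_left)
    also have "\<dots> = hat (axial F) - (1/2) *\<^sub>R (transpose F ** F)" by (simp add: hat_axial sym)
    finally have "norm F \<le> norm (hat (axial F)) + norm ((1/2) *\<^sub>R (transpose F ** F))"
      by (metis norm_triangle_ineq4)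
    also have "\<dots> \<le> norm (axial F) * K2 + (norm F * norm F * K4) / 2"
      using K2(2)[of "axial F"] K4(2)[of F F] by simp
    also have "norm F * norm F * K4 \<le> norm F * 1"
      unfolding mult.assoc
      by (intro mult_left_mono) (use that K4 in \<open>auto simp: nF field_simps\<close>)
    finally have "norm F \<le> 2 * K2 * norm (axial F)" by (simp add: algebra_simps)
    also have "\<dots> \<le> K * norm (axial F)" by (intro mult_right_mono K) auto
    finally show ?thesis by (simp only: nF Zk_axial F_def[symmetric])
  qed
  show ?thesis
  proof (rule that[of K "1 / K4"])
    show "norm (vee (Zk R0 R)) \<le> K * norm (R - R0)" if "R0 \<in> SO3" for R0 R
    proof -
      have "norm (vee (Zk R0 R)) \<le> K1 * norm (R - R0)"
        using K1(2)[of "transpose R0 ** (R - R0)"] norm_relative_attitude[OF that, of "R - R0"]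
        by (simp add: Zk_axial mult.commute)
      also have "\<dots> \<le> K * norm (R - R0)" by (intro mult_right_mono K) auto
      finally show ?thesis .
    qed
    show "norm (axial (transpose R0 ** (R - R0) ** hat w)) \<le> K * norm (R - R0) * norm w"
      if "R0 \<in> SO3" for R0 R w
    proof -
      have "norm (axial (transpose R0 ** (R - R0) ** hat w)) \<le> K3 * (norm (R - R0) * norm w)"
        using K3(2)[of "transpose R0 ** (R - R0)" w] norm_relative_attitude[OF that, of "R - R0"]
        by (simp add: mult_ac)
      also have "\<dots> \<le> K * (norm (R - R0) * norm w)" by (intro mult_right_mono K) auto
      finally show ?thesis by (simp add: mult_ac)
    qed
  qed (use K K4 near in auto)
qed

lemma attitude_error_derivative:
  assumes R0: "(R0 has_vector_derivative R0 t ** hat w0) (at t within S)" "R0 t \<in> SO3"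
    and R: "(R has_vector_derivative R t ** hat w) (at t within S)"
    and SO3: "\<And>s. s \<in> S \<Longrightarrow> R0 s \<in> SO3" and t: "t \<in> S"
  shows "((\<lambda>s. vee (Zk (R0 s) (R s))) has_vector_derivative
     vee (Zk (R0 t) (R t)) \<times> w0 + (w - w0)
       + axial (transpose (R0 t) ** (R t - R0 t) ** hat (w - w0))) (at t within S)"
proof -
  let ?F = "transpose (R0 t) ** (R t - R0 t)"
  have blt: "bounded_linear (transpose :: real^3^3 \<Rightarrow> real^3^3)"
    using linear_transpose linear_conv_bounded_linear by blast
  have bla: "bounded_linear axial" using linear_axial linear_conv_bounded_linear by blast
  have hat_t: "transpose (hat w0) = - hat w0"
    by (simp add: hat_def transpose_def vec_eq_iff forall_3 vector_3)
  have "((\<lambda>s. axial (transpose (R0 s) ** R s)) has_vector_derivative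
      axial (transpose (R0 t) ** (R t ** hat w) + transpose (R0 t ** hat w0) ** R t)) (at t within S)"
    by (rule bounded_linear.has_vector_derivative[OF bla]
             bounded_bilinear.has_vector_derivative[OF bounded_bilinear_matrix_mult]
             bounded_linear.has_vector_derivative[OF blt] R0 R)+
  also have "transpose (R0 t) ** (R t ** hat w) + transpose (R0 t ** hat w0) ** R t
      = (mat 1 + ?F) ** hat w - hat w0 ** (mat 1 + ?F)"
    unfolding relative_attitude[OF R0(2), symmetric]
    by (simp add: matrix_transpose_mul hat_t matrix_mul_assoc
        bounded_bilinear.minus_left[OF bounded_bilinear_matrix_mult])
  finally have "((\<lambda>s. axial (transpose (R0 s) ** R s)) has_vector_derivative
     axial ?F \<times> w0 + (w - w0) + axial (?F ** hat (w - w0))) (at t within S)"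
    by (simp only: axial_error_rate)
  then show ?thesis
    unfolding Zk_axial[symmetric]
    by (rule has_vector_derivative_transform[OF t, rotated]) (simp add: Zk_eq SO3 axial_def)
qed


section \<open>Exponential tracking from quadratic Lyapunov functions\<close>

text \<open>The estimates on \<open>V\<close> are available only while the error stays below \<open>r\<close>. A first-exit argument removes this
restriction: up to the first time at which the error equals \<open>r\<close> the function \<open>V\<close> has not increased, so the
error is still below \<open>r\<close> if it started below \<open>r sqrt (a / b)\<close>. The upper bound on \<open>V\<close> is imposed at the initial
time alone, since an integral state is bounded by the tracking error there but not later.\<close>

lemma lyapunov_tracking:
  fixes a b c r :: real
  assumes pos: "0 < a" "0 < b" "0 < c" "0 < r"
    and T: "T \<subseteq> {0..}"
    and R0: "continuous_on {0..} R0" and W0: "continuous_on {0..} W0"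
    and V: "\<And>t0 R W. t0 \<in> T \<Longrightarrow> closed_loop_solution u t0 R W \<Longrightarrow>
       \<exists>V V'. (tracking_error R0 W0 R W t0 \<le> r \<longrightarrow> V t0 \<le> b * (tracking_error R0 W0 R W t0)\<^sup>2) \<and>
         (\<forall>t\<ge>t0. (V has_real_derivative V' t) (at t within {t0..}) \<and>
           (tracking_error R0 W0 R W t \<le> r \<longrightarrow>
             a * (tracking_error R0 W0 R W t)\<^sup>2 \<le> V t \<and> V' t \<le> - c * V t))"
  shows "tracks_exponentially T u R0 W0"
proof -
  define \<delta> where "\<delta> = min r (r * sqrt (a / b))"
  define C where "C = sqrt (b / a)"
  have \<delta>: "0 < \<delta>" and C: "0 < C" using pos by (auto simp: \<delta>_def C_def)
  have bound: "tracking_error R0 W0 R W t1 \<le> C * exp (- (c / 2) * (t1 - t0)) * tracking_error R0 W0 R W t0"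
    if t0: "t0 \<in> T" and sol: "closed_loop_solution u t0 R W"
      and small: "tracking_error R0 W0 R W t0 < \<delta>" and t1: "t0 \<le> t1" for t0 t1 R W
  proof -
    define e where "e = tracking_error R0 W0 R W"
    have e_nonneg: "0 \<le> e t" for t by (simp add: e_def tracking_error_def)
    obtain V V' where V0: "e t0 \<le> r \<Longrightarrow> V t0 \<le> b * (e t0)\<^sup>2"
      and V1: "\<And>t. t0 \<le> t \<Longrightarrow> (V has_real_derivative V' t) (at t within {t0..})"
      and V2: "\<And>t. t0 \<le> t \<Longrightarrow> e t \<le> r \<Longrightarrow> a * (e t)\<^sup>2 \<le> V t"
      and V3: "\<And>t. t0 \<le> t \<Longrightarrow> e t \<le> r \<Longrightarrow> V' t \<le> - c * V t"
      using V[OF t0 sol] unfolding e_def by blast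
    have e0: "e t0 < r" "e t0 < r * sqrt (a / b)" using small by (auto simp: e_def \<delta>_def)
    have V0': "V t0 \<le> b * (e t0)\<^sup>2" using V0 e0 by simp
    have sub: "{t0..} \<subseteq> {0..}" using t0 T by auto
    have "continuous_on {t0..} R" "continuous_on {t0..} W"
      using sol unfolding closed_loop_solution_def
      by (auto intro!: has_vector_derivative_continuous simp: continuous_on_eq_continuous_within)
    then have e_cont: "continuous_on {t0..} e"
      unfolding e_def tracking_error_def using R0 W0 sub
      by (auto intro!: continuous_intros intro: continuous_on_subset)
    have decay: "V s \<le> exp (- c * (s - t0)) * V t0"
      if s: "t0 \<le> s" and small_s: "\<And>t. t0 \<le> t \<Longrightarrow> t < s \<Longrightarrow> e t \<le> r" for s
    proof -
      let ?U = "\<lambda>t. exp (c * (t - t0)) * V t"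
      have dU: "(?U has_real_derivative exp (c * (t - t0)) * (c * V t + V' t)) (at t within {t0..})"
        if "t0 \<le> t" for t
        using V1[OF that] by (auto intro!: derivative_eq_intros simp: algebra_simps)
      have "?U s \<le> ?U t0"
      proof (rule DERIV_nonpos_imp_decreasing_open[OF s])
        fix t assume t: "t0 < t" "t < s"
        have "(?U has_real_derivative exp (c * (t - t0)) * (c * V t + V' t)) (at t)"
          using dU[of t] t at_within_interior[of t "{t0..}"] by simp
        moreover have "exp (c * (t - t0)) * (c * V t + V' t) \<le> 0"
          using V3[of t] small_s[of t] t by (intro mult_nonneg_nonpos) auto
        ultimately show "\<exists>y. (?U has_real_derivative y) (at t) \<and> y \<le> 0" by blast
      next
        have "continuous_on {t0..} ?U"
          using dU by (auto intro!: DERIV_continuous simp: continuous_on_eq_continuous_within)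
        then show "continuous_on {t0..s} ?U" by (rule continuous_on_subset) auto
      qed
      have "exp (- c * (s - t0)) * exp (c * (s - t0)) = 1"
        by (simp add: mult_exp_exp)
      then have "V s = exp (- c * (s - t0)) * ?U s" by (simp only: mult.assoc[symmetric] mult_1)
      also have "\<dots> \<le> exp (- c * (s - t0)) * ?U t0"
        using \<open>?U s \<le> ?U t0\<close> by (intro mult_left_mono) auto
      also have "?U t0 = V t0" by simp
      finally show ?thesis .
    qed
    have stays: "e t < r" if t: "t0 \<le> t" for t
    proof (rule ccontr)
      assume "\<not> e t < r"
      define S where "S = {s \<in> {t0..t}. e s = r}"
      have "S \<noteq> {}"
        using IVT'[of e t0 r t] \<open>\<not> e t < r\<close> e0 t continuous_on_subset[OF e_cont, of "{t0..t}"]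
        by (auto simp: S_def)
      have "compact S"
      proof -
        have "closed ({t0..t} \<inter> e -` {r})"
          by (rule continuous_closed_preimage) (auto intro: continuous_on_subset[OF e_cont])
        moreover have "S = {t0..t} \<inter> e -` {r}" by (auto simp: S_def)
        ultimately have "closed S" by simp
        moreover have "bounded S" by (rule bounded_subset[of "{t0..t}"]) (auto simp: S_def)
        ultimately show ?thesis by (simp add: compact_eq_bounded_closed)
      qed
      then obtain s where s: "s \<in> S" "\<And>x. x \<in> S \<Longrightarrow> s \<le> x"
        using compact_attains_inf[OF _ \<open>S \<noteq> {}\<close>] by blast
      have "e x \<le> r" if x: "t0 \<le> x" "x < s" for x
      proof (rule ccontr)
        assume "\<not> e x \<le> r"
        then obtain y where "t0 \<le> y" "y \<le> x" "e y = r"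
          using IVT'[of e t0 r x] e0 x continuous_on_subset[OF e_cont, of "{t0..x}"] by auto
        then have "y \<in> S" using s(1) x by (auto simp: S_def)
        then show False using s(2)[of y] \<open>y \<le> x\<close> x by simp
      qed
      then have "V s \<le> exp (- c * (s - t0)) * V t0" using s(1) by (intro decay) (auto simp: S_def)
      moreover have "a * r\<^sup>2 \<le> V s" using V2[of s] s(1) by (auto simp: S_def)
      moreover have "0 \<le> V t0" using V2[of t0] e0 pos by (smt (verit) mult_nonneg_nonneg zero_le_power2)
      then have "exp (- c * (s - t0)) * V t0 \<le> 1 * V t0"
        using s(1) pos by (intro mult_right_mono) (auto simp: S_def)
      moreover have "b * (e t0)\<^sup>2 < b * (r * sqrt (a / b))\<^sup>2"
        using e0 pos e_nonneg by (intro mult_strict_left_mono power_strict_mono) auto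
      moreover have "b * (r * sqrt (a / b))\<^sup>2 = a * r\<^sup>2"
        using pos by (simp add: power_mult_distrib)
      ultimately show False using V0' by linarith
    qed
    have "a * (e t1)\<^sup>2 \<le> V t1" using V2 stays t1 by (simp add: less_imp_le)
    also have "\<dots> \<le> exp (- c * (t1 - t0)) * V t0"
      by (rule decay) (use t1 stays in \<open>auto intro: less_imp_le\<close>)
    also have "\<dots> \<le> exp (- c * (t1 - t0)) * (b * (e t0)\<^sup>2)"
      using V0' by (intro mult_left_mono) auto
    finally have "(e t1)\<^sup>2 \<le> (b / a) * exp (- c * (t1 - t0)) * (e t0)\<^sup>2"
      using pos by (simp add: field_simps)
    also have "\<dots> = (C * exp (- (c / 2) * (t1 - t0)) * e t0)\<^sup>2"
    proof -
      have "(exp (- (c / 2) * (t1 - t0)))\<^sup>2 = exp (2 * (- (c / 2) * (t1 - t0)))"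
        by (rule exp_double[symmetric])
      moreover have "C\<^sup>2 = b / a" using pos by (simp add: C_def)
      ultimately show ?thesis by (simp only: power_mult_distrib) simp
    qed
    finally have "(e t1)\<^sup>2 \<le> (C * exp (- (c / 2) * (t1 - t0)) * e t0)\<^sup>2" .
    moreover have "0 \<le> C * exp (- (c / 2) * (t1 - t0)) * e t0" using C e_nonneg[of t0] by simp
    ultimately have "e t1 \<le> C * exp (- (c / 2) * (t1 - t0)) * e t0" by (rule power2_le_imp_le)
    then show ?thesis by (simp only: e_def)
  qed
  show ?thesis
    unfolding tracks_exponentially_def
    by (rule exI[of _ C], rule conjI[OF C], rule exI[of _ "c / 2"], rule conjI,
        use pos in simp, rule exI[of _ \<delta>], rule conjI[OF \<delta>]) (use bound in blast)
qed

text \<open>Lyapunov's indirect approach: \<open>g\<close> is the part of the dynamics for which \<open>\<beta>\<close> decreases and \<open>\<rho>\<close> is of second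
order, so that its contribution to the derivative of \<open>\<beta> x x\<close> is absorbed once the error is small.\<close>

lemma quadratic_lyapunov_tracking:
  fixes \<beta> :: "'a::euclidean_space \<Rightarrow> 'a \<Rightarrow> real"
  assumes \<beta>: "bounded_bilinear \<beta>" "\<And>x y. \<beta> x y = \<beta> y x" "\<And>x. a * (norm x)\<^sup>2 \<le> \<beta> x x"
    and pos: "0 < a" "0 < c" "0 < K" "0 < r"
    and T: "T \<subseteq> {0..}"
    and R0: "continuous_on {0..} R0" and W0: "continuous_on {0..} W0"
    and x: "\<And>t0 R W. t0 \<in> T \<Longrightarrow> closed_loop_solution u t0 R W \<Longrightarrow>
       \<exists>x g \<rho>. norm (x t0) \<le> K * tracking_error R0 W0 R W t0 \<and>
         (\<forall>t\<ge>t0. (x has_vector_derivative g t + \<rho> t) (at t within {t0..}) \<and>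
           \<beta> (x t) (g t) \<le> - c * (norm (x t))\<^sup>2 \<and>
           (tracking_error R0 W0 R W t \<le> r \<longrightarrow>
             tracking_error R0 W0 R W t \<le> K * norm (x t) \<and>
             norm (\<rho> t) \<le> K * tracking_error R0 W0 R W t * norm (x t)))"
  shows "tracks_exponentially T u R0 W0"
proof -
  obtain B where B: "0 < B" "\<And>x y. norm (\<beta> x y) \<le> norm x * norm y * B"
    using bounded_bilinear.pos_bounded[OF \<beta>(1)] by blast
  \<comment> \<open>Half of the decay rate \<open>2 c\<close> of the form is spent on the remainder: for errors up to \<open>q\<close> it contributes at
most \<open>c \<bar>x\<bar>\<^sup>2\<close>.\<close>
  define q where "q = min r (c / (2 * B * K))"
  have q: "0 < q" using pos B by (simp add: q_def)
  show ?thesis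
  proof (rule lyapunov_tracking[of "a / K\<^sup>2" "B * K\<^sup>2" "c / B" q])
    fix t0 R W assume "t0 \<in> T" "closed_loop_solution u t0 R W"
    from x[OF this] obtain x g \<rho>
      where x0: "norm (x t0) \<le> K * tracking_error R0 W0 R W t0"
        and dx: "\<And>t. t0 \<le> t \<Longrightarrow> (x has_vector_derivative g t + \<rho> t) (at t within {t0..})"
        and g: "\<And>t. t0 \<le> t \<Longrightarrow> \<beta> (x t) (g t) \<le> - c * (norm (x t))\<^sup>2"
        and ex: "\<And>t. t0 \<le> t \<Longrightarrow> tracking_error R0 W0 R W t \<le> r \<Longrightarrow> tracking_error R0 W0 R W t \<le> K * norm (x t)"
        and \<rho>: "\<And>t. t0 \<le> t \<Longrightarrow> tracking_error R0 W0 R W t \<le> r \<Longrightarrow>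
               norm (\<rho> t) \<le> K * tracking_error R0 W0 R W t * norm (x t)"
      by blast
    define e where "e = tracking_error R0 W0 R W"
    have e_nonneg: "0 \<le> e t" for t by (simp add: e_def tracking_error_def)
    define V where "V t = \<beta> (x t) (x t)" for t
    define V' where "V' t = 2 * \<beta> (x t) (g t + \<rho> t)" for t
    have V_le: "V t \<le> B * (norm (x t))\<^sup>2" for t
      using B(2)[of "x t" "x t"] by (simp add: V_def power2_eq_square mult_ac)
    have dV: "(V has_real_derivative V' t) (at t within {t0..})" if "t0 \<le> t" for t
      using bounded_bilinear.has_vector_derivative[OF \<beta>(1) dx[OF that] dx[OF that]] \<beta>(2)
      unfolding has_real_derivative_iff_has_vector_derivative V_def V'_def by simp
    have V0: "V t0 \<le> (B * K\<^sup>2) * (e t0)\<^sup>2"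
    proof -
      have "(norm (x t0))\<^sup>2 \<le> (K * e t0)\<^sup>2" using x0 by (intro power_mono) (auto simp: e_def)
      then have "B * (norm (x t0))\<^sup>2 \<le> B * (K * e t0)\<^sup>2" using B(1) by (intro mult_left_mono) auto
      then show ?thesis using V_le[of t0] by (simp add: power_mult_distrib)
    qed
    have low: "(a / K\<^sup>2) * (e t)\<^sup>2 \<le> V t" if "t0 \<le> t" "e t \<le> q" for t
    proof -
      have "(e t)\<^sup>2 \<le> (K * norm (x t))\<^sup>2"
        using ex[of t] that e_nonneg[of t] by (intro power_mono) (auto simp: e_def q_def)
      then have "(a / K\<^sup>2) * (e t)\<^sup>2 \<le> (a / K\<^sup>2) * (K * norm (x t))\<^sup>2"
        using pos by (intro mult_left_mono) auto
      also have "\<dots> = a * (norm (x t))\<^sup>2" using pos by (simp add: power_mult_distrib)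
      finally show ?thesis using \<beta>(3)[of "x t"] by (simp add: V_def)
    qed
    have dec: "V' t \<le> - (c / B) * V t" if "t0 \<le> t" "e t \<le> q" for t
    proof -
      have "norm (\<rho> t) \<le> (K * e t) * norm (x t)" using \<rho>[of t] that by (simp add: e_def q_def)
      also have "\<dots> \<le> (K * (c / (2 * B * K))) * norm (x t)"
        using that pos by (intro mult_right_mono mult_left_mono) (auto simp: q_def)
      also have "\<dots> = c / (2 * B) * norm (x t)" using pos by simp
      finally have "norm (x t) * norm (\<rho> t) * B \<le> norm (x t) * (c / (2 * B) * norm (x t)) * B"
        using B(1) by (intro mult_right_mono mult_left_mono) auto
      also have "\<dots> = c / 2 * (norm (x t))\<^sup>2" using B(1) by (simp add: power2_eq_square)
      finally have "\<beta> (x t) (\<rho> t) \<le> c / 2 * (norm (x t))\<^sup>2"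
        using B(2)[of "x t" "\<rho> t"] by simp
      then have "V' t \<le> - c * (norm (x t))\<^sup>2"
        using g[OF that(1)] by (simp add: V'_def bounded_bilinear.add_right[OF \<beta>(1)])
      moreover have "(c / B) * V t \<le> (c / B) * (B * (norm (x t))\<^sup>2)"
        using V_le[of t] pos B(1) by (intro mult_left_mono) auto
      ultimately show ?thesis using B(1) by simp
    qed
    show "\<exists>V V'. (tracking_error R0 W0 R W t0 \<le> q \<longrightarrow> V t0 \<le> (B * K\<^sup>2) * (tracking_error R0 W0 R W t0)\<^sup>2) \<and>
         (\<forall>t\<ge>t0. (V has_real_derivative V' t) (at t within {t0..}) \<and>
           (tracking_error R0 W0 R W t \<le> q \<longrightarrow>
             (a / K\<^sup>2) * (tracking_error R0 W0 R W t)\<^sup>2 \<le> V t \<and> V' t \<le> - (c / B) * V t))"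
      unfolding e_def[symmetric]
    proof (rule exI[of _ V], rule exI[of _ V'], intro conjI allI impI)
      show "V t0 \<le> (B * K\<^sup>2) * (e t0)\<^sup>2" by (rule V0)
      fix t assume "t0 \<le> t"
      then show "(V has_real_derivative V' t) (at t within {t0..})" by (rule dV)
      assume "e t \<le> q"
      with \<open>t0 \<le> t\<close> show "(a / K\<^sup>2) * (e t)\<^sup>2 \<le> V t" "V' t \<le> - (c / B) * V t"
        by (simp_all only: low dec)
    qed
  qed (use pos B(1) q T R0 W0 in simp_all)
qed


section \<open>The four control laws\<close>

lemma norm_cross_le: "norm (x \<times> y) \<le> norm x * norm y"
proof (rule power2_le_imp_le)
  show "(norm (x \<times> y))\<^sup>2 \<le> (norm x * norm y)\<^sup>2"
    using norm_cross_dot[of x y] by (metis le_add_same_cancel1 zero_le_power2)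
qed simp

locale reference_trajectory =
  fixes R0 :: "real \<Rightarrow> real^3^3" and W0 u0 :: "real \<Rightarrow> real^3" and B :: real
  assumes R0_SO3: "0 \<le> t \<Longrightarrow> R0 t \<in> SO3"
    and dR0: "0 \<le> t \<Longrightarrow> (R0 has_vector_derivative R0 t ** hat (W0 t)) (at t within {0..})"
    and dW0: "0 \<le> t \<Longrightarrow> (W0 has_vector_derivative u0 t) (at t within {0..})"
    and B: "0 \<le> B" "0 \<le> t \<Longrightarrow> norm (W0 t) \<le> B"
begin

definition "attitude_error R t = vee (Zk (R0 t) (R t))"
text \<open>The derivative of the attitude error is the sum of its linear part \<open>error_rate\<close> and a second order defect.\<close>

definition "error_rate R W t = attitude_error R t \<times> W0 t + (W t - W0 t)"
definition "kinematic_defect R W t = axial (transpose (R0 t) ** (R t - R0 t) ** hat (W t - W0 t))"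

lemma continuous_R0: "continuous_on {0..} R0" and continuous_W0: "continuous_on {0..} W0"
  using dR0 dW0
  by (auto intro!: has_vector_derivative_continuous simp: continuous_on_eq_continuous_within)

lemma error_derivatives:
  assumes sol: "closed_loop_solution u t0 R W" and t: "0 \<le> t0" "t0 \<le> t"
  shows "(attitude_error R has_vector_derivative error_rate R W t + kinematic_defect R W t) (at t within {t0..})"
    and "((\<lambda>s. W s - W0 s) has_vector_derivative u R W t - u0 t) (at t within {t0..})"
    and "(W0 has_vector_derivative u0 t) (at t within {t0..})"
proof -
  have sub: "{t0..} \<subseteq> {0..}" using t by auto
  have R0': "(R0 has_vector_derivative R0 t ** hat (W0 t)) (at t within {t0..})"
    using dR0[of t] t sub by (auto intro: has_vector_derivative_within_subset)
  show W0': "(W0 has_vector_derivative u0 t) (at t within {t0..})"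
    using dW0[of t] t sub by (auto intro: has_vector_derivative_within_subset)
  have R': "(R has_vector_derivative R t ** hat (W t)) (at t within {t0..})"
    and W': "(W has_vector_derivative u R W t) (at t within {t0..})"
    using sol t by (auto simp: closed_loop_solution_def)
  show "((\<lambda>s. W s - W0 s) has_vector_derivative u R W t - u0 t) (at t within {t0..})"
    by (rule has_vector_derivative_diff[OF W' W0'])
  show "(attitude_error R has_vector_derivative error_rate R W t + kinematic_defect R W t) (at t within {t0..})"
    using attitude_error_derivative[OF R0' _ R'] t R0_SO3
    by (simp add: attitude_error_def[abs_def] error_rate_def kinematic_defect_def)
qed

lemma rate_derivative:
  assumes sol: "closed_loop_solution u t0 R W" and t: "0 \<le> t0" "t0 \<le> t"
  shows "(error_rate R W has_vector_derivative
    (error_rate R W t + kinematic_defect R W t) \<times> W0 t + attitude_error R t \<times> u0 t + (u R W t - u0 t)) (at t within {t0..})"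
proof -
  note d = error_derivatives[OF assms]
  have "bounded_bilinear (\<times>)" using bilinear_cross bilinear_conv_bounded_bilinear by blast
  from has_vector_derivative_add[OF bounded_bilinear.has_vector_derivative[OF this d(1) d(3)] d(2)]
  show ?thesis by (simp add: error_rate_def[abs_def] add.commute)
qed

lemma error_estimates:
  obtains K r where "0 < K" "0 < r"
    "\<And>u t0 R W t. closed_loop_solution u t0 R W \<Longrightarrow> 0 \<le> t0 \<Longrightarrow> t0 \<le> t \<Longrightarrow>
       norm (attitude_error R t) \<le> K * tracking_error R0 W0 R W t \<and>
       norm (W t - W0 t) \<le> tracking_error R0 W0 R W t \<and>
       norm (kinematic_defect R W t) \<le> K * tracking_error R0 W0 R W t * norm (W t - W0 t) \<and>
       (tracking_error R0 W0 R W t \<le> r \<longrightarrow>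
         tracking_error R0 W0 R W t \<le> K * norm (attitude_error R t) + norm (W t - W0 t))"
proof -
  obtain K r where K: "0 < K" "0 < r"
    and est: "\<And>R0 R. R0 \<in> SO3 \<Longrightarrow> norm (vee (Zk R0 R)) \<le> K * norm (R - R0)"
      "\<And>R0 R. R0 \<in> SO3 \<Longrightarrow> R \<in> SO3 \<Longrightarrow> norm (R - R0) \<le> r \<Longrightarrow> norm (R - R0) \<le> K * norm (vee (Zk R0 R))"
      "\<And>R0 R w. R0 \<in> SO3 \<Longrightarrow> norm (axial (transpose R0 ** (R - R0) ** hat w)) \<le> K * norm (R - R0) * norm w"
    by (rule attitude_error_estimates) (rule that)
  show ?thesis
  proof (rule that[OF K], intro conjI impI)
    fix u t0 R W t
    assume sol: "closed_loop_solution u t0 R W" and t: "0 \<le> t0" "t0 \<le> t"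
    have SO3: "R0 t \<in> SO3" "R t \<in> SO3" using sol t R0_SO3 by (auto simp: closed_loop_solution_def)
    let ?e = "tracking_error R0 W0 R W t"
    have e: "norm (R t - R0 t) \<le> ?e" by (simp add: tracking_error_def)
    show "norm (attitude_error R t) \<le> K * ?e"
      using est(1)[OF SO3(1), of "R t"] mult_left_mono[OF e less_imp_le[OF K(1)]]
      unfolding attitude_error_def by linarith
    show "norm (W t - W0 t) \<le> ?e" by (simp add: tracking_error_def)
    have "K * norm (R t - R0 t) * norm (W t - W0 t) \<le> K * ?e * norm (W t - W0 t)"
      using e K by (intro mult_right_mono mult_left_mono) auto
    then show "norm (kinematic_defect R W t) \<le> K * ?e * norm (W t - W0 t)"
      using est(3)[OF SO3(1), of "R t" "W t - W0 t"] by (simp add: kinematic_defect_def)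
    assume "?e \<le> r"
    then have "norm (R t - R0 t) \<le> K * norm (attitude_error R t)"
      unfolding attitude_error_def using e by (intro est(2) SO3) simp
    then show "?e \<le> K * norm (attitude_error R t) + norm (W t - W0 t)" by (simp add: tracking_error_def)
  qed
qed

text \<open>The feedback terms of the first two laws cancel the reference exactly: with \<open>z\<close> the attitude error and
\<open>y = error_rate\<close>, the closed loop is \<open>z' = y + d\<close> and \<open>y' = (feedback) + d \<times> W0\<close>, where the defect \<open>d\<close> is of
second order. Hence the state, possibly augmented by an integral, obeys a constant linear system up to a
remainder \<open>\<rho>\<close>. Boundedness of \<open>W0\<close> makes \<open>(z, y)\<close> equivalent to the tracking error, uniformly in time.\<close>

lemma hurwitz_tracking:
  fixes A :: "'a::euclidean_space \<Rightarrow> 'a"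
  assumes A: "linear A" "left_hurwitz A" and T: "T \<subseteq> {0..}"
    and x: "\<And>t0 R W. t0 \<in> T \<Longrightarrow> closed_loop_solution u t0 R W \<Longrightarrow>
      \<exists>x \<rho>. norm (x t0) \<le> norm (attitude_error R t0) + norm (error_rate R W t0) \<and>
        (\<forall>t\<ge>t0. (x has_vector_derivative A (x t) + \<rho> t) (at t within {t0..}) \<and>
          norm (attitude_error R t) \<le> norm (x t) \<and> norm (error_rate R W t) \<le> norm (x t) \<and>
          norm (\<rho> t) \<le> norm (kinematic_defect R W t) + norm (kinematic_defect R W t \<times> W0 t))"
  shows "tracks_exponentially T u R0 W0"
proof -
  obtain \<beta> c where \<beta>: "bounded_bilinear \<beta>" "\<And>x y. \<beta> x y = \<beta> y x"
    "\<And>x. (norm x)\<^sup>2 \<le> \<beta> x x" "0 < c" "\<And>x. \<beta> x (A x) \<le> - c * (norm x)\<^sup>2"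
    by (rule hurwitz_lyapunov[OF A]) (rule that)
  obtain K r where K: "0 < K" "0 < r"
    and est: "\<And>u t0 R W t. closed_loop_solution u t0 R W \<Longrightarrow> 0 \<le> t0 \<Longrightarrow> t0 \<le> t \<Longrightarrow>
       norm (attitude_error R t) \<le> K * tracking_error R0 W0 R W t \<and>
       norm (W t - W0 t) \<le> tracking_error R0 W0 R W t \<and>
       norm (kinematic_defect R W t) \<le> K * tracking_error R0 W0 R W t * norm (W t - W0 t) \<and>
       (tracking_error R0 W0 R W t \<le> r \<longrightarrow>
         tracking_error R0 W0 R W t \<le> K * norm (attitude_error R t) + norm (W t - W0 t))"
    by (rule error_estimates) (rule that)
  define L where "L = (1 + B)\<^sup>2 * (K + 1)"
  have L: "0 < L" "(1 + B) * K + 1 \<le> L" "K + B + 1 \<le> L" "(1 + B)\<^sup>2 * K \<le> L"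
  proof -
    have "0 \<le> B * K" "0 \<le> B\<^sup>2 * K" "0 \<le> B\<^sup>2" using B(1) K by auto
    moreover have "L = K + 1 + 2 * (B * K) + 2 * B + B\<^sup>2 * K + B\<^sup>2"
      by (simp add: L_def power2_eq_square algebra_simps)
    moreover have "(1 + B)\<^sup>2 * K = K + 2 * (B * K) + B\<^sup>2 * K"
      by (simp add: power2_eq_square algebra_simps)
    ultimately show "0 < L" "(1 + B) * K + 1 \<le> L" "K + B + 1 \<le> L" "(1 + B)\<^sup>2 * K \<le> L"
      using B(1) K by (simp_all only: distrib_right mult_1)
  qed
  show ?thesis
  proof (rule quadratic_lyapunov_tracking[OF \<beta>(1,2) _ zero_less_one \<beta>(4) L(1) K(2) T continuous_R0 continuous_W0])
    show "1 * (norm x)\<^sup>2 \<le> \<beta> x x" for x using \<beta>(3) by simp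
    fix t0 R W assume t0: "t0 \<in> T" and sol: "closed_loop_solution u t0 R W"
    have t0': "0 \<le> t0" using t0 T by auto
    obtain x \<rho> where x0: "norm (x t0) \<le> norm (attitude_error R t0) + norm (error_rate R W t0)"
      and dx: "\<And>t. t0 \<le> t \<Longrightarrow> (x has_vector_derivative A (x t) + \<rho> t) (at t within {t0..})"
      and nx: "\<And>t. t0 \<le> t \<Longrightarrow> norm (attitude_error R t) \<le> norm (x t)"
        "\<And>t. t0 \<le> t \<Longrightarrow> norm (error_rate R W t) \<le> norm (x t)"
      and \<rho>: "\<And>t. t0 \<le> t \<Longrightarrow> norm (\<rho> t) \<le> norm (kinematic_defect R W t) + norm (kinematic_defect R W t \<times> W0 t)"
      using x[OF t0 sol] by blast
    define e where "e t = tracking_error R0 W0 R W t" for t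
    have e_nonneg: "0 \<le> e t" for t by (simp add: e_def tracking_error_def)
    have zW: "norm (z \<times> W0 t) \<le> B * norm z" if "t0 \<le> t" for z t
      using norm_cross_le[of z "W0 t"] mult_left_mono[OF B(2), of t "norm z"] that t0'
      by (simp add: mult.commute)
    have velocity: "norm (W t - W0 t) \<le> B * norm (attitude_error R t) + norm (error_rate R W t)" if "t0 \<le> t" for t
    proof -
      have "W t - W0 t = error_rate R W t - attitude_error R t \<times> W0 t" by (simp add: error_rate_def)
      then show ?thesis
        using norm_triangle_ineq4[of "error_rate R W t" "attitude_error R t \<times> W0 t"] zW[OF that, of "attitude_error R t"] by simp
    qed
    have init: "norm (x t0) \<le> L * e t0"
    proof -
      have "norm (error_rate R W t0) \<le> B * norm (attitude_error R t0) + norm (W t0 - W0 t0)"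
        using norm_triangle_ineq[of "attitude_error R t0 \<times> W0 t0" "W t0 - W0 t0"] zW[of t0 "attitude_error R t0"]
        by (simp add: error_rate_def)
      then have "norm (x t0) \<le> (1 + B) * norm (attitude_error R t0) + norm (W t0 - W0 t0)"
        using x0 by (simp add: algebra_simps)
      also have "\<dots> \<le> (1 + B) * (K * e t0) + e t0"
        using est[OF sol t0' order_refl] B(1) by (intro add_mono mult_left_mono) (auto simp: e_def)
      also have "\<dots> = ((1 + B) * K + 1) * e t0" by (simp add: algebra_simps)
      also have "\<dots> \<le> L * e t0" by (intro mult_right_mono L e_nonneg)
      finally show ?thesis .
    qed
    have step: "(x has_vector_derivative A (x t) + \<rho> t) (at t within {t0..}) \<and>
        \<beta> (x t) (A (x t)) \<le> - c * (norm (x t))\<^sup>2 \<and>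
        (e t \<le> r \<longrightarrow> e t \<le> L * norm (x t) \<and> norm (\<rho> t) \<le> L * e t * norm (x t))"
      if t: "t0 \<le> t" for t
    proof (intro conjI impI)
      note est' = est[OF sol t0' t, folded e_def]
      have v: "norm (W t - W0 t) \<le> (1 + B) * norm (x t)"
        using velocity[OF t] mult_left_mono[OF nx(1)[OF t] B(1)] nx(2)[OF t] by (simp add: algebra_simps)
      show "(x has_vector_derivative A (x t) + \<rho> t) (at t within {t0..})" by (rule dx[OF t])
      show "\<beta> (x t) (A (x t)) \<le> - c * (norm (x t))\<^sup>2" by (rule \<beta>(5))
      assume "e t \<le> r"
      then have "e t \<le> K * norm (attitude_error R t) + norm (W t - W0 t)" using est' by blast
      also have "\<dots> \<le> K * norm (x t) + (1 + B) * norm (x t)"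
        using nx(1)[OF t] v K by (intro add_mono mult_left_mono) auto
      also have "\<dots> = (K + B + 1) * norm (x t)" by (simp add: algebra_simps)
      also have "\<dots> \<le> L * norm (x t)" by (intro mult_right_mono L) auto
      finally show "e t \<le> L * norm (x t)" .
      have "norm (\<rho> t) \<le> (1 + B) * norm (kinematic_defect R W t)"
        using \<rho>[OF t] zW[OF t, of "kinematic_defect R W t"] by (simp add: algebra_simps)
      also have "\<dots> \<le> (1 + B) * (K * e t * ((1 + B) * norm (x t)))"
      proof (intro mult_left_mono)
        have "norm (kinematic_defect R W t) \<le> K * e t * norm (W t - W0 t)" using est' by blast
        also have "\<dots> \<le> K * e t * ((1 + B) * norm (x t))"
          using v K e_nonneg by (intro mult_left_mono) auto
        finally show "norm (kinematic_defect R W t) \<le> K * e t * ((1 + B) * norm (x t))" .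
      qed (use B(1) in simp)
      also have "\<dots> = ((1 + B)\<^sup>2 * K) * (e t * norm (x t))" by (simp add: power2_eq_square mult_ac)
      also have "\<dots> \<le> L * (e t * norm (x t))" using e_nonneg by (intro mult_right_mono L) auto
      finally show "norm (\<rho> t) \<le> L * e t * norm (x t)" by (simp add: mult_ac)
    qed
    show "\<exists>x g \<rho>. norm (x t0) \<le> L * tracking_error R0 W0 R W t0 \<and>
         (\<forall>t\<ge>t0. (x has_vector_derivative g t + \<rho> t) (at t within {t0..}) \<and>
           \<beta> (x t) (g t) \<le> - c * (norm (x t))\<^sup>2 \<and>
           (tracking_error R0 W0 R W t \<le> r \<longrightarrow>
             tracking_error R0 W0 R W t \<le> L * norm (x t) \<and>
             norm (\<rho> t) \<le> L * tracking_error R0 W0 R W t * norm (x t)))"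
      unfolding e_def[symmetric]
      by (rule exI[of _ x], rule exI[of _ "\<lambda>t. A (x t)"], rule exI[of _ \<rho>])
         (intro conjI allI impI init step)
  qed
qed

lemma tracks_PD:
  assumes "hurwitz_matrix (block_matrix 0 (mat 1) (- KP) (- KD))"
  shows "tracks_exponentially {0..} (control_PD KP KD R0 W0 u0) R0 W0"
proof (rule hurwitz_tracking[OF _ left_hurwitz_PD[OF assms]])
  let ?A = "\<lambda>x. (snd x, - (KP *v fst x) - KD *v snd x)"
  show "linear ?A"
    by (simp add: linear_iff matrix_vector_right_distrib matrix_vector_mult_scaleR algebra_simps)
  fix t0 R W assume "t0 \<in> {0 :: real..}" and sol: "closed_loop_solution (control_PD KP KD R0 W0 u0) t0 R W"
  then have t0: "0 \<le> t0" by simp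
  let ?x = "\<lambda>t. (attitude_error R t, error_rate R W t)" and ?\<rho> = "\<lambda>t. (kinematic_defect R W t, kinematic_defect R W t \<times> W0 t)"
  have "(?x has_vector_derivative ?A (?x t) + ?\<rho> t) (at t within {t0..})" if t: "t0 \<le> t" for t
  proof -
    have "control_PD KP KD R0 W0 u0 R W t - u0 t
        = - (KP *v attitude_error R t) - KD *v error_rate R W t - error_rate R W t \<times> W0 t - attitude_error R t \<times> u0 t"
      by (simp add: control_PD_def Let_def attitude_error_def error_rate_def)
    then have "(error_rate R W t + kinematic_defect R W t) \<times> W0 t + attitude_error R t \<times> u0 t
          + (control_PD KP KD R0 W0 u0 R W t - u0 t)
        = - (KP *v attitude_error R t) - KD *v error_rate R W t + kinematic_defect R W t \<times> W0 t"
      by (simp add: cross_add_left)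
    then show ?thesis
      using has_vector_derivative_Pair[OF error_derivatives(1)[OF sol t0 t] rate_derivative[OF sol t0 t]]
      by simp
  qed
  then show "\<exists>x \<rho>. norm (x t0) \<le> norm (attitude_error R t0) + norm (error_rate R W t0) \<and>
        (\<forall>t\<ge>t0. (x has_vector_derivative ?A (x t) + \<rho> t) (at t within {t0..}) \<and>
          norm (attitude_error R t) \<le> norm (x t) \<and> norm (error_rate R W t) \<le> norm (x t) \<and>
          norm (\<rho> t) \<le> norm (kinematic_defect R W t) + norm (kinematic_defect R W t \<times> W0 t))"
    by (intro exI[of _ ?x] exI[of _ ?\<rho>] conjI allI impI norm_Pair_le norm_fst_le norm_snd_le)
qed simp

text \<open>The integral state vanishes at the initial time \<open>0\<close>, so the full state is bounded there by the tracking error.\<close>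

lemma tracks_PID:
  assumes "hurwitz_poly (pid_poly KP KD KI)"
  shows "tracks_exponentially {0} (control_PID KP KD KI R0 W0 u0) R0 W0"
proof (rule hurwitz_tracking[OF _ left_hurwitz_PID[OF assms]])
  let ?A = "\<lambda>x. (fst (snd x), snd (snd x), - (KI *v fst x) - KP *v fst (snd x) - KD *v snd (snd x))"
  show "linear ?A"
    by (simp add: linear_iff matrix_vector_right_distrib matrix_vector_mult_scaleR algebra_simps)
  fix t0 R W assume "t0 \<in> {0 :: real}" and sol': "closed_loop_solution (control_PID KP KD KI R0 W0 u0) t0 R W"
  then have t0: "t0 = 0" by simp
  note sol = sol'[unfolded t0]
  define w where "w t = integral {0..t} (attitude_error R)" for t
  have cont: "continuous_on {0..} (attitude_error R)"
    using error_derivatives(1)[OF sol order_refl]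
    by (auto intro!: has_vector_derivative_continuous simp: continuous_on_eq_continuous_within)
  have dw: "(w has_vector_derivative attitude_error R t) (at t within {0..})" if t: "0 \<le> t" for t
  proof -
    have "(w has_vector_derivative attitude_error R t) (at t within {0..t + 1})"
      unfolding w_def using t
      by (intro integral_has_vector_derivative continuous_on_subset[OF cont]) auto
    moreover have "at t within {0..t + 1} = at t within {0..}"
      by (rule at_within_nhd[of _ "{..<t + 1}"]) auto
    ultimately show ?thesis by simp
  qed
  let ?x = "\<lambda>t. (w t, attitude_error R t, error_rate R W t)"
    and ?\<rho> = "\<lambda>t. (0 :: real^3, kinematic_defect R W t, kinematic_defect R W t \<times> W0 t)"
  have dx: "(?x has_vector_derivative ?A (?x t) + ?\<rho> t) (at t within {0..})" if t: "0 \<le> t" for t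
  proof -
    have "control_PID KP KD KI R0 W0 u0 R W t - u0 t
        = - (KI *v w t) - KP *v attitude_error R t - KD *v error_rate R W t - error_rate R W t \<times> W0 t - attitude_error R t \<times> u0 t"
      by (simp add: control_PID_def Let_def attitude_error_def[abs_def] error_rate_def w_def)
    then have "(error_rate R W t + kinematic_defect R W t) \<times> W0 t + attitude_error R t \<times> u0 t
          + (control_PID KP KD KI R0 W0 u0 R W t - u0 t)
        = - (KI *v w t) - KP *v attitude_error R t - KD *v error_rate R W t + kinematic_defect R W t \<times> W0 t"
      by (simp add: cross_add_left)
    then show ?thesis
      using has_vector_derivative_Pair[OF dw[OF t] has_vector_derivative_Pair[OF
          error_derivatives(1)[OF sol order_refl t] rate_derivative[OF sol order_refl t]]]
      by simp
  qed
  have init: "norm (?x 0) \<le> norm (attitude_error R 0) + norm (error_rate R W 0)"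
    using norm_Pair_le[of "w 0" "(attitude_error R 0, error_rate R W 0)"] norm_Pair_le[of "attitude_error R 0" "error_rate R W 0"]
    by (simp add: w_def)
  have \<rho>: "norm (?\<rho> t) \<le> norm (kinematic_defect R W t) + norm (kinematic_defect R W t \<times> W0 t)" for t
    using norm_Pair_le[of "0 :: real^3" "snd (?\<rho> t)"] norm_Pair_le[of "kinematic_defect R W t" "kinematic_defect R W t \<times> W0 t"]
    by simp
  have n: "norm (attitude_error R t) \<le> norm (?x t)" "norm (error_rate R W t) \<le> norm (?x t)" for t
    using norm_snd_le[of "(attitude_error R t, error_rate R W t)" "w t"] norm_fst_le[of "attitude_error R t" "error_rate R W t"]
      norm_snd_le[of "error_rate R W t" "attitude_error R t"] by linarith+
  show "\<exists>x \<rho>. norm (x t0) \<le> norm (attitude_error R t0) + norm (error_rate R W t0) \<and>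
        (\<forall>t\<ge>t0. (x has_vector_derivative ?A (x t) + \<rho> t) (at t within {t0..}) \<and>
          norm (attitude_error R t) \<le> norm (x t) \<and> norm (error_rate R W t) \<le> norm (x t) \<and>
          norm (\<rho> t) \<le> norm (kinematic_defect R W t) + norm (kinematic_defect R W t \<times> W0 t))"
    unfolding t0
    by (rule exI[of _ ?x], rule exI[of _ ?\<rho>]) (intro conjI allI impI dx init \<rho> n)
qed simp

text \<open>The linearised closed loop has the time-dependent coefficient \<open>W0\<close> and is handled by the mechanical energy
\<open>(kP \<bar>z\<bar>\<^sup>2 + \<bar>h\<bar>\<^sup>2) / 2\<close> with the cross term \<open>\<epsilon> z \<bullet> h\<close>, where \<open>h = W - W0\<close>; the form \<open>\<beta>\<close> below is twice this.
The cross term makes the attitude error dissipate. The time-dependent terms of its derivative combine to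
\<open>(\<epsilon> - \<sigma>) h \<bullet> (z \<times> W0)\<close>. For \<open>\<sigma> = \<epsilon>\<close> they cancel, which is the purpose of the additional feedback term and
leads to a bound on \<open>\<epsilon>\<close> independent of the reference; for \<open>\<sigma> = 0\<close> they are dominated by taking \<open>\<epsilon>\<close> small.
The condition on \<open>\<epsilon>\<close> and \<open>m\<close> says that the resulting form in \<open>\<bar>z\<bar>\<close> and \<open>\<bar>h\<bar>\<close> is definite.\<close>

lemma energy_tracking:
  fixes kP \<epsilon> \<sigma> m L L' :: real and KD :: "real^3^3"
  assumes kP: "0 < kP" and \<epsilon>: "0 < \<epsilon>" "\<epsilon>\<^sup>2 < kP" "\<epsilon> * (4 * kP + L'\<^sup>2) < 4 * kP * m"
    and KD: "\<And>v. m * (norm v)\<^sup>2 \<le> v \<bullet> (KD *v v)" "\<And>v. norm (KD *v v) \<le> L * norm v"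
    and cross: "\<And>t. 0 \<le> t \<Longrightarrow> \<bar>\<epsilon> - \<sigma>\<bar> * norm (W0 t) + \<epsilon> * L \<le> \<epsilon> * L'"
  shows "tracks_exponentially {0..} (control_eps kP KD \<sigma> R0 W0 u0) R0 W0"
proof -
  define \<beta> :: "(real^3) \<times> (real^3) \<Rightarrow> (real^3) \<times> (real^3) \<Rightarrow> real" where
    "\<beta> p q = kP * (fst p \<bullet> fst q) + snd p \<bullet> snd q + \<epsilon> * (fst p \<bullet> snd q + snd p \<bullet> fst q)" for p q
  have norm2: "(norm p)\<^sup>2 = (norm (fst p))\<^sup>2 + (norm (snd p))\<^sup>2" for p :: "(real^3) \<times> (real^3)"
    by (simp add: norm_prod_def)
  have bilin: "bounded_bilinear \<beta>"
    unfolding bilinear_conv_bounded_bilinear[symmetric] bilinear_def linear_iff \<beta>_def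
    by (simp add: inner_add_left inner_add_right algebra_simps)
  have sym: "\<beta> p q = \<beta> q p" for p q by (simp add: \<beta>_def inner_commute algebra_simps)
  have "(2 * \<epsilon>)\<^sup>2 < 4 * kP * 1" using \<epsilon>(2) by (simp add: power_mult_distrib)
  then obtain a where a: "0 < a" "\<And>x y. a * (x\<^sup>2 + y\<^sup>2) \<le> kP * x\<^sup>2 + 1 * y\<^sup>2 - (2 * \<epsilon>) * x * y"
    by (rule quadratic_form_coercive[OF kP zero_less_one]) (rule that)
  have lower: "a * (norm p)\<^sup>2 \<le> \<beta> p p" for p
  proof -
    have "- (norm (fst p) * norm (snd p)) \<le> fst p \<bullet> snd p"
      using Cauchy_Schwarz_ineq2[of "fst p" "snd p"] by linarith
    then have "2 * \<epsilon> * - (norm (fst p) * norm (snd p)) \<le> 2 * \<epsilon> * (fst p \<bullet> snd p)"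
      using \<epsilon>(1) by (intro mult_left_mono) auto
    moreover have "\<beta> p p = kP * (norm (fst p))\<^sup>2 + (norm (snd p))\<^sup>2 + 2 * \<epsilon> * (fst p \<bullet> snd p)"
      by (simp add: \<beta>_def power2_norm_eq_inner inner_commute algebra_simps)
    ultimately show ?thesis
      using a(2)[of "norm (fst p)" "norm (snd p)"] by (simp add: norm2 mult_ac)
  qed
  have m: "\<epsilon> < m"
  proof -
    have "\<epsilon> * (4 * kP) \<le> \<epsilon> * (4 * kP + L'\<^sup>2)" using \<epsilon>(1) by (intro mult_left_mono) auto
    then have "(4 * kP) * \<epsilon> < (4 * kP) * m" using \<epsilon>(3) by (simp add: mult_ac)
    then show ?thesis using kP by simp
  qed
  have "\<epsilon> * (\<epsilon> * L'\<^sup>2) < \<epsilon> * (4 * kP * (m - \<epsilon>))"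
    using \<epsilon>(3) \<epsilon>(1) by (intro mult_strict_left_mono) (auto simp: algebra_simps)
  then have "(\<epsilon> * L')\<^sup>2 < 4 * (\<epsilon> * kP) * (m - \<epsilon>)" by (simp add: power2_eq_square mult_ac)
  then obtain c where c: "0 < c"
      "\<And>x y. c * (x\<^sup>2 + y\<^sup>2) \<le> (\<epsilon> * kP) * x\<^sup>2 + (m - \<epsilon>) * y\<^sup>2 - (\<epsilon> * L') * x * y"
    by (rule quadratic_form_coercive[rotated 2]) (use \<epsilon>(1) kP m that in auto)
  define g where "g t p = (fst p \<times> W0 t + snd p, - (kP *\<^sub>R fst p) - KD *v snd p - \<sigma> *\<^sub>R (fst p \<times> W0 t))"
    for t p
  have decay: "\<beta> p (g t p) \<le> - c * (norm p)\<^sup>2" if t: "0 \<le> t" for t p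
  proof -
    let ?z = "fst p" and ?h = "snd p"
    have "\<beta> p (g t p) = - (?h \<bullet> (KD *v ?h)) + \<epsilon> * (norm ?h)\<^sup>2 - \<epsilon> * kP * (norm ?z)\<^sup>2
        + ((\<epsilon> - \<sigma>) * (?h \<bullet> (?z \<times> W0 t)) - \<epsilon> * (?z \<bullet> (KD *v ?h)))"
      by (simp add: \<beta>_def g_def inner_add_right inner_diff_right dot_cross_self
          power2_norm_eq_inner inner_commute algebra_simps)
    also have "(\<epsilon> - \<sigma>) * (?h \<bullet> (?z \<times> W0 t)) - \<epsilon> * (?z \<bullet> (KD *v ?h)) \<le> (\<epsilon> * L') * norm ?z * norm ?h"
    proof -
      have "\<bar>?h \<bullet> (?z \<times> W0 t)\<bar> \<le> norm ?h * (norm ?z * norm (W0 t))"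
        using Cauchy_Schwarz_ineq2[of ?h "?z \<times> W0 t"] mult_left_mono[OF norm_cross_le norm_ge_zero]
        by (rule order_trans)
      then have 1: "\<bar>(\<epsilon> - \<sigma>) * (?h \<bullet> (?z \<times> W0 t))\<bar> \<le> \<bar>\<epsilon> - \<sigma>\<bar> * (norm ?h * (norm ?z * norm (W0 t)))"
        unfolding abs_mult by (intro mult_left_mono) auto
      have "\<bar>?z \<bullet> (KD *v ?h)\<bar> \<le> norm ?z * (L * norm ?h)"
        using Cauchy_Schwarz_ineq2[of ?z "KD *v ?h"] mult_left_mono[OF KD(2) norm_ge_zero]
        by (rule order_trans)
      then have 2: "\<bar>\<epsilon> * (?z \<bullet> (KD *v ?h))\<bar> \<le> \<epsilon> * (norm ?z * (L * norm ?h))"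
        unfolding abs_mult using \<epsilon>(1) by (simp add: mult_left_mono)
      have "(\<bar>\<epsilon> - \<sigma>\<bar> * norm (W0 t) + \<epsilon> * L) * (norm ?z * norm ?h) \<le> \<epsilon> * L' * (norm ?z * norm ?h)"
        by (intro mult_right_mono cross t) auto
      then show ?thesis using 1 2 by (simp add: algebra_simps)
    qed
    also have "- (?h \<bullet> (KD *v ?h)) \<le> - (m * (norm ?h)\<^sup>2)" using KD(1)[of ?h] by simp
    finally show ?thesis
      using c(2)[of "norm ?z" "norm ?h"] by (simp add: norm2 algebra_simps)
  qed
  obtain K r where K: "0 < K" "0 < r"
    and est: "\<And>u t0 R W t. closed_loop_solution u t0 R W \<Longrightarrow> 0 \<le> t0 \<Longrightarrow> t0 \<le> t \<Longrightarrow>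
       norm (attitude_error R t) \<le> K * tracking_error R0 W0 R W t \<and>
       norm (W t - W0 t) \<le> tracking_error R0 W0 R W t \<and>
       norm (kinematic_defect R W t) \<le> K * tracking_error R0 W0 R W t * norm (W t - W0 t) \<and>
       (tracking_error R0 W0 R W t \<le> r \<longrightarrow>
         tracking_error R0 W0 R W t \<le> K * norm (attitude_error R t) + norm (W t - W0 t))"
    by (rule error_estimates) (rule that)
  have K1: "0 < K + 1" using K by simp
  show ?thesis
  proof (rule quadratic_lyapunov_tracking[OF bilin sym lower a(1) c(1) K1 K(2) order_refl continuous_R0 continuous_W0])
    fix t0 R W assume "t0 \<in> {0 :: real..}" and sol: "closed_loop_solution (control_eps kP KD \<sigma> R0 W0 u0) t0 R W"
    then have t0: "0 \<le> t0" by simp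
    define e where "e t = tracking_error R0 W0 R W t" for t
    have e_nonneg: "0 \<le> e t" for t by (simp add: e_def tracking_error_def)
    define x where "x t = (attitude_error R t, W t - W0 t)" for t
    define \<rho> where "\<rho> t = (kinematic_defect R W t, 0 :: real^3)" for t
    have nx: "norm (attitude_error R t) \<le> norm (x t)" "norm (W t - W0 t) \<le> norm (x t)" for t
      unfolding x_def by (rule norm_fst_le norm_snd_le)+
    have init: "norm (x t0) \<le> (K + 1) * e t0"
      using est[OF sol t0 order_refl] norm_Pair_le[of "attitude_error R t0" "W t0 - W0 t0"]
      by (simp add: x_def e_def algebra_simps)
    have step: "(x has_vector_derivative g t (x t) + \<rho> t) (at t within {t0..}) \<and>
        \<beta> (x t) (g t (x t)) \<le> - c * (norm (x t))\<^sup>2 \<and>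
        (e t \<le> r \<longrightarrow> e t \<le> (K + 1) * norm (x t) \<and> norm (\<rho> t) \<le> (K + 1) * e t * norm (x t))"
      if t: "t0 \<le> t" for t
    proof (intro conjI impI)
      note est' = est[OF sol t0 t, folded e_def]
      have "control_eps kP KD \<sigma> R0 W0 u0 R W t - u0 t
          = - (kP *\<^sub>R attitude_error R t) - KD *v (W t - W0 t) - \<sigma> *\<^sub>R (attitude_error R t \<times> W0 t)"
        by (simp add: control_eps_def Let_def attitude_error_def)
      then show "(x has_vector_derivative g t (x t) + \<rho> t) (at t within {t0..})"
        using has_vector_derivative_Pair[OF error_derivatives(1,2)[OF sol t0 t]]
        by (simp add: x_def[abs_def] g_def \<rho>_def error_rate_def)
      show "\<beta> (x t) (g t (x t)) \<le> - c * (norm (x t))\<^sup>2" using t t0 by (intro decay) simp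
      have "norm (\<rho> t) \<le> K * e t * norm (W t - W0 t)" using est' by (simp add: \<rho>_def)
      also have "\<dots> \<le> (K + 1) * e t * norm (x t)"
        using nx(2)[of t] e_nonneg[of t] K by (intro mult_mono) auto
      finally show "norm (\<rho> t) \<le> (K + 1) * e t * norm (x t)" .
      assume "e t \<le> r"
      then have "e t \<le> K * norm (attitude_error R t) + norm (W t - W0 t)" using est' by blast
      also have "\<dots> \<le> K * norm (x t) + norm (x t)"
        using nx K by (intro add_mono mult_left_mono) auto
      finally show "e t \<le> (K + 1) * norm (x t)" by (simp add: algebra_simps)
    qed
    show "\<exists>x g \<rho>. norm (x t0) \<le> (K + 1) * tracking_error R0 W0 R W t0 \<and>
         (\<forall>t\<ge>t0. (x has_vector_derivative g t + \<rho> t) (at t within {t0..}) \<and>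
           \<beta> (x t) (g t) \<le> - c * (norm (x t))\<^sup>2 \<and>
           (tracking_error R0 W0 R W t \<le> r \<longrightarrow>
             tracking_error R0 W0 R W t \<le> (K + 1) * norm (x t) \<and>
             norm (\<rho> t) \<le> (K + 1) * tracking_error R0 W0 R W t * norm (x t)))"
      unfolding e_def[symmetric]
      by (rule exI[of _ x], rule exI[of _ "\<lambda>t. g t (x t)"], rule exI[of _ \<rho>])
         (intro conjI allI impI init step)
  qed
qed

text \<open>Here \<open>\<epsilon>\<close> occurs in the Lyapunov function only and is chosen small depending on the bound \<open>B\<close> of the
reference velocity.\<close>

lemma tracks_simple:
  assumes kP: "0 < kP" and KD: "sym_pos_def KD"
  shows "tracks_exponentially {0..} (control_simple kP KD R0 W0 u0) R0 W0"
proof -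
  note bounds = sym_pos_def_bounds[OF KD]
  let ?m = "lambda_min KD" and ?L = "lambda_max KD"
  let ?q = "4 * kP + (?L + B)\<^sup>2"
  have q: "0 < ?q" using kP by (simp add: add_pos_nonneg)
  define \<epsilon> where "\<epsilon> = min (sqrt kP) (4 * kP * ?m / ?q) / 2"
  have \<epsilon>: "0 < \<epsilon>" "\<epsilon> < sqrt kP" "\<epsilon> < 4 * kP * ?m / ?q"
  proof -
    have half: "0 < min a b / 2 \<and> min a b / 2 < a \<and> min a b / 2 < b" if "0 < a" "0 < b" for a b :: real
      using that by (auto simp: min_def)
    have "0 < sqrt kP" "0 < 4 * kP * ?m / ?q" using kP bounds(1) q by simp_all
    from half[OF this] show "0 < \<epsilon>" "\<epsilon> < sqrt kP" "\<epsilon> < 4 * kP * ?m / ?q"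
      unfolding \<epsilon>_def by blast+
  qed
  have "control_simple kP KD R0 W0 u0 = control_eps kP KD 0 R0 W0 u0"
    by (simp add: fun_eq_iff control_simple_def control_eps_def)
  moreover have "tracks_exponentially {0..} (control_eps kP KD 0 R0 W0 u0) R0 W0"
  proof (rule energy_tracking[OF kP \<epsilon>(1) _ _ bounds(3,4)])
    show "\<epsilon>\<^sup>2 < kP" using \<epsilon> kP power_strict_mono[of \<epsilon> "sqrt kP" 2] by simp
    show "\<epsilon> * ?q < 4 * kP * ?m" using \<epsilon>(3) q by (simp add: pos_less_divide_eq)
    show "\<bar>\<epsilon> - 0\<bar> * norm (W0 t) + \<epsilon> * ?L \<le> \<epsilon> * (?L + B)" if "0 \<le> t" for t
      using mult_left_mono[OF B(2)[OF that], of \<epsilon>] \<epsilon>(1) by (simp add: algebra_simps)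
  qed
  ultimately show ?thesis by simp
qed

lemma tracks_eps:
  assumes kP: "0 < kP" and KD: "sym_pos_def KD" and \<epsilon>: "0 < \<epsilon>"
    "\<epsilon> < min (sqrt kP) (4 * kP * lambda_min KD / (4 * kP + (lambda_max KD)\<^sup>2))"
  shows "tracks_exponentially {0..} (control_eps kP KD \<epsilon> R0 W0 u0) R0 W0"
proof (rule energy_tracking[OF kP \<epsilon>(1) _ _ sym_pos_def_bounds(3,4)[OF KD]])
  show "\<epsilon>\<^sup>2 < kP" using \<epsilon> kP power_strict_mono[of \<epsilon> "sqrt kP" 2] by simp
  have "0 < 4 * kP + (lambda_max KD)\<^sup>2" using kP by (simp add: add_pos_nonneg)
  then show "\<epsilon> * (4 * kP + (lambda_max KD)\<^sup>2) < 4 * kP * lambda_min KD"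
    using \<epsilon>(2) by (simp add: pos_less_divide_eq)
qed simp

end

theorem mainTheorem6:
  fixes R0 :: "real \<Rightarrow> real^3^3" and W0 u0 :: "real \<Rightarrow> real^3"
  assumes "smooth_on_half_line R0" and "smooth_on_half_line W0" and "smooth_on_half_line u0"
    and "bounded (R0 ` {0..})" and "bounded (W0 ` {0..})" and "bounded (u0 ` {0..})"
    and "\<And>t. t \<ge> 0 \<Longrightarrow> R0 t \<in> SO3"
    and "\<And>t. t \<ge> 0 \<Longrightarrow> (R0 has_vector_derivative R0 t ** hat (W0 t)) (at t within {0..})"
    and "\<And>t. t \<ge> 0 \<Longrightarrow> (W0 has_vector_derivative u0 t) (at t within {0..})"
  shows
    "(\<forall>KP KD :: real^3^3.
        hurwitz_matrix (block_matrix 0 (mat 1) (- KP) (- KD)) \<longrightarrow>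
        tracks_exponentially {0..} (control_PD KP KD R0 W0 u0) R0 W0) \<and>
     (\<forall>KP KD KI :: real^3^3.
        hurwitz_poly (pid_poly KP KD KI) \<longrightarrow>
        tracks_exponentially {0} (control_PID KP KD KI R0 W0 u0) R0 W0) \<and>
     (\<forall>(kP :: real) (KD :: real^3^3).
        kP > 0 \<and> sym_pos_def KD \<longrightarrow>
        tracks_exponentially {0..} (control_simple kP KD R0 W0 u0) R0 W0) \<and>
     (\<forall>(kP :: real) (KD :: real^3^3) (\<epsilon> :: real).
        kP > 0 \<and> sym_pos_def KD \<and> 0 < \<epsilon> \<and>
        \<epsilon> < min (sqrt kP) (4 * kP * lambda_min KD / (4 * kP + (lambda_max KD)\<^sup>2)) \<longrightarrow>
        tracks_exponentially {0..} (control_eps kP KD \<epsilon> R0 W0 u0) R0 W0)"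
proof -
  obtain B where B: "\<And>t. t \<in> {0..} \<Longrightarrow> norm (W0 t) \<le> B"
    using \<open>bounded (W0 ` {0..})\<close> by (auto simp: bounded_iff)
  have "0 \<le> B" using B[of 0] norm_ge_zero[of "W0 0"] by (simp del: norm_ge_zero)
  interpret reference_trajectory R0 W0 u0 B
    by unfold_locales (use assms(7-9) B \<open>0 \<le> B\<close> in auto)
  show ?thesis
    by (intro conjI allI impI tracks_PD tracks_PID) (auto intro: tracks_simple tracks_eps)
qed

end
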